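(* Let $(M,\circ,g,e,E)$ be a homogeneous (pseudo-)Riemannian F-manifold with Killing unit vector field, let $\theta(X):=g(e,X)$, and let $\nabla$ be the connection $$\nabla_X Y=\widetilde\nabla_X Y-\tfrac12\left(\iota_{X\circ Y}d\theta\right)^\sharp ,$$ where $\widetilde\nabla$ is the Levi-Civita connection of $g$, $\iota_X$ is the contraction with $X$, and $\sharp$ is the isomorphism from one-forms to vector fields induced by $g^{-1}$. Then $(M,\circ,\nabla,e,E)$ is a homogeneous flat F-manifold.
   Context: $M$ is a smooth manifold; "vector field" means smooth local vector field; metrics are pseudo-Riemannian (nondegenerate, symmetric). $d\theta(X,Y)=X(\theta(Y))-Y(\theta(X))-\theta([X,Y])$ and $\iota_X d\theta=d\theta(X,\cdot)$. The Riemann tensor of a connection $\nabla$ is $R(X,Y)Z=\nabla_X\nabla_YZ-\nabla_Y\nabla_XZ-\nabla_{[X,Y]}Z$. $\mathcal L$ denotes the Lie derivative, and $\circ$ is viewed as a $(1,2)$ tensor. F-manifold: a triple $(M,\circ,e)$ where $\circ$ is a commutative associative $C^\infty$-bilinear product on vector fields such that $\mathcal L_{X\circ Y}(\circ)=X\circ\mathcal L_Y(\circ)+Y\circ\mathcal L_X(\circ)$ for all vector fields $X,Y$, and $e$ is a vector field with $e\circ X=X$ for all $X$. (Pseudo-)Riemannian F-manifold with Killing unit vector field: an F-manifold $(M,\circ,e)$ with a (pseudo-)Riemannian metric $g$ such that (i) $g(X\circ Y,Z)=g(X,Y\circ Z)$; (ii) the Riemann tensor $R$ of $g$ satisfies $R(Y,Z)(X\circ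 W)+R(X,Y)(Z\circ W)+R(Z,X)(Y\circ W)=0$ for all vector fields $X,Y,Z,W$; (iii) $\mathcal L_e g=0$. It is homogeneous if it is equipped with a vector field $E$ (the Euler vector field) such that $\mathcal L_E\circ=\circ$ and $\mathcal L_E g=Dg$ for some constant $D$. Flat F-manifold: a tuple $(M,\circ,\nabla,e)$ where $\circ$ is a commutative associative $C^\infty$-bilinear product on vector fields with unit vector field $e$, and $\nabla$ is a torsionless flat connection with $\nabla e=0$ that is compatible with the product, i.e. writing $c(X,Y)=X\circ Y$, the expression $(\nabla_X c)(Y,Z)$ is symmetric in $X,Y,Z$. A homogeneous flat F-manifold is a flat F-manifold equipped with a vector field $E$ satisfying $\mathcal L_E\circ=\circ$ and $\nabla\nabla E=0$. *)

theory Defs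
  imports "HOL-Analysis.Analysis" "HOL-Library.Function_Algebras"
begin

primrec Ck_on :: "nat \<Rightarrow> 'e::real_normed_vector set \<Rightarrow> ('e \<Rightarrow> 'b::real_normed_vector) \<Rightarrow> bool" where
  "Ck_on 0 S f \<longleftrightarrow> continuous_on S f"
| "Ck_on (Suc k) S f \<longleftrightarrow> (\<forall>x\<in>S. f differentiable (at x)) \<and>
     (\<forall>v. Ck_on k S (\<lambda>x. frechet_derivative f (at x) v))"

text \<open>Only used for open \<open>S\<close>.\<close>

definition smooth_on :: "'e::real_normed_vector set \<Rightarrow> ('e \<Rightarrow> 'b::real_normed_vector) \<Rightarrow> bool" where
  "smooth_on S f \<longleftrightarrow> (\<forall>k. Ck_on k S f)"

text \<open>The points of the manifold are the points of the space \<open>mtop\<close>; a chart is a pair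
  \<open>(W, \<phi>)\<close> of its domain and its coordinate map, which is only meaningful on \<open>W\<close>.\<close>

record ('a, 'e) mfd =
  mtop :: "'a topology"
  charts :: "('a set \<times> ('a \<Rightarrow> 'e)) set"

abbreviation carr :: "('a, 'e) mfd \<Rightarrow> 'a set" where
  "carr M \<equiv> topspace (mtop M)"

definition smooth_manifold :: "('a, 'e::euclidean_space) mfd \<Rightarrow> bool" where
  "smooth_manifold M \<longleftrightarrow>
     Hausdorff_space (mtop M) \<and> second_countable (mtop M) \<and>
     (\<Union>(W, \<phi>)\<in>charts M. W) = carr M \<and>
     (\<forall>(W, \<phi>)\<in>charts M. openin (mtop M) W \<and> open (\<phi> ` W) \<and>
        homeomorphic_map (subtopology (mtop M) W) (top_of_set (\<phi> ` W)) \<phi>) \<and>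
     (\<forall>(W, \<phi>)\<in>charts M. \<forall>(W', \<psi>)\<in>charts M.
        smooth_on (\<phi> ` (W \<inter> W')) (\<psi> \<circ> inv_into W \<phi>))"

definition smooth_fun :: "('a, 'e::euclidean_space) mfd \<Rightarrow> 'a set \<Rightarrow> ('a \<Rightarrow> real) \<Rightarrow> bool" where
  "smooth_fun M U f \<longleftrightarrow> openin (mtop M) U \<and>
     (\<forall>(W, \<phi>)\<in>charts M. smooth_on (\<phi> ` (U \<inter> W)) (f \<circ> inv_into W \<phi>))"

definition smooth_near :: "('a, 'e::euclidean_space) mfd \<Rightarrow> 'a \<Rightarrow> ('a \<Rightarrow> real) \<Rightarrow> bool" where
  "smooth_near M p f \<longleftrightarrow> (\<exists>U. p \<in> U \<and> smooth_fun M U f)"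

text \<open>A tangent vector at \<open>p\<close> is the directional derivative operator at \<open>p\<close> with some coordinate
  vector \<open>v\<close> in some chart, acting on the functions that are smooth near \<open>p\<close>.  It is given the value
  \<open>0\<close> on all other functions, so that equality of tangent vectors is equality of functionals.
  Addition, difference and zero of tangent vectors and of vector fields are the pointwise ones of
  the function types.\<close>

type_synonym 'a tvec = "('a \<Rightarrow> real) \<Rightarrow> real"
type_synonym 'a vfield = "'a \<Rightarrow> 'a tvec"

definition coord_vector ::
  "('a, 'e::euclidean_space) mfd \<Rightarrow> 'a set \<Rightarrow> ('a \<Rightarrow> 'e) \<Rightarrow> 'a \<Rightarrow> 'e \<Rightarrow> 'a tvec" where
  "coord_vector M W \<phi> p v = (\<lambda>f. if smooth_near M p f
     then frechet_derivative (f \<circ> inv_into W \<phi>) (at (\<phi> p)) v else 0)"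

definition tangent_space :: "('a, 'e::euclidean_space) mfd \<Rightarrow> 'a \<Rightarrow> 'a tvec set" where
  "tangent_space M p = {coord_vector M W \<phi> p v | W \<phi> v. (W, \<phi>) \<in> charts M \<and> p \<in> W}"

definition tscale :: "real \<Rightarrow> 'a tvec \<Rightarrow> 'a tvec" where
  "tscale c v = (\<lambda>f. c * v f)"

definition vscale :: "('a \<Rightarrow> real) \<Rightarrow> 'a vfield \<Rightarrow> 'a vfield" where
  "vscale a X = (\<lambda>p. tscale (a p) (X p))"

text \<open>Smooth vector fields on an open set \<open>U\<close>; the values outside \<open>U\<close> are irrelevant.\<close>

definition smooth_vf :: "('a, 'e::euclidean_space) mfd \<Rightarrow> 'a set \<Rightarrow> 'a vfield \<Rightarrow> bool" where
  "smooth_vf M U X \<longleftrightarrow> openin (mtop M) U \<and> (\<forall>p\<in>U. X p \<in> tangent_space M p) \<and>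
     (\<forall>V f. V \<subseteq> U \<and> smooth_fun M V f \<longrightarrow> smooth_fun M V (\<lambda>p. X p f))"

definition lie_bracket ::
  "('a, 'e::euclidean_space) mfd \<Rightarrow> 'a vfield \<Rightarrow> 'a vfield \<Rightarrow> 'a vfield" where
  "lie_bracket M X Y = (\<lambda>p f. if smooth_near M p f
     then X p (\<lambda>q. Y q f) - Y p (\<lambda>q. X q f) else 0)"

text \<open>A one-form is used through its action on local vector fields.\<close>

type_synonym 'a form1 = "'a vfield \<Rightarrow> 'a \<Rightarrow> real"
type_synonym 'a form2 = "'a vfield \<Rightarrow> 'a vfield \<Rightarrow> 'a \<Rightarrow> real"

definition ext_deriv :: "('a, 'e::euclidean_space) mfd \<Rightarrow> 'a form1 \<Rightarrow> 'a form2" where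
  "ext_deriv M \<theta> X Y = (\<lambda>p. X p (\<theta> Y) - Y p (\<theta> X) - \<theta> (lie_bracket M X Y) p)"

definition contract :: "'a vfield \<Rightarrow> 'a form2 \<Rightarrow> 'a form1" where
  "contract X \<omega> = (\<lambda>Y. \<omega> X Y)"

type_synonym 'a tproduct = "'a \<Rightarrow> 'a tvec \<Rightarrow> 'a tvec \<Rightarrow> 'a tvec"
type_synonym 'a tmetric = "'a \<Rightarrow> 'a tvec \<Rightarrow> 'a tvec \<Rightarrow> real"

definition vprod :: "'a tproduct \<Rightarrow> 'a vfield \<Rightarrow> 'a vfield \<Rightarrow> 'a vfield" where
  "vprod m X Y = (\<lambda>p. m p (X p) (Y p))"

definition vinner :: "'a tmetric \<Rightarrow> 'a vfield \<Rightarrow> 'a vfield \<Rightarrow> 'a \<Rightarrow> real" where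
  "vinner g X Y = (\<lambda>p. g p (X p) (Y p))"

text \<open>Linearity in the second argument follows from commutativity, resp. symmetry.\<close>

definition comm_assoc_product :: "('a, 'e::euclidean_space) mfd \<Rightarrow> 'a tproduct \<Rightarrow> bool" where
  "comm_assoc_product M m \<longleftrightarrow>
     (\<forall>p\<in>carr M. \<forall>u\<in>tangent_space M p. \<forall>v\<in>tangent_space M p.
        m p u v \<in> tangent_space M p \<and>
        m p u v = m p v u \<and>
        (\<forall>c. m p (tscale c u) v = tscale c (m p u v)) \<and>
        (\<forall>w\<in>tangent_space M p.
           m p (u + w) v = m p u v + m p w v \<and>
           m p (m p u v) w = m p u (m p v w))) \<and>
     (\<forall>U X Y. smooth_vf M U X \<and> smooth_vf M U Y \<longrightarrow> smooth_vf M U (vprod m X Y))"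

definition unit_field :: "('a, 'e::euclidean_space) mfd \<Rightarrow> 'a tproduct \<Rightarrow> 'a vfield \<Rightarrow> bool" where
  "unit_field M m e \<longleftrightarrow> smooth_vf M (carr M) e \<and>
     (\<forall>p\<in>carr M. \<forall>u\<in>tangent_space M p. m p (e p) u = u)"

definition pseudo_metric :: "('a, 'e::euclidean_space) mfd \<Rightarrow> 'a tmetric \<Rightarrow> bool" where
  "pseudo_metric M g \<longleftrightarrow>
     (\<forall>p\<in>carr M. \<forall>u\<in>tangent_space M p.
        (\<forall>v\<in>tangent_space M p.
           g p u v = g p v u \<and>
           (\<forall>c. g p (tscale c u) v = c * g p u v) \<and>
           (\<forall>w\<in>tangent_space M p. g p (u + w) v = g p u v + g p w v)) \<and>
        ((\<forall>v\<in>tangent_space M p. g p u v = 0) \<longrightarrow> u = 0)) \<and>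
     (\<forall>U X Y. smooth_vf M U X \<and> smooth_vf M U Y \<longrightarrow> smooth_fun M U (vinner g X Y))"

text \<open>The vector field \<open>\<alpha>\<^sup>\<sharp>\<close> with \<open>g(\<alpha>\<^sup>\<sharp>, Y) = \<alpha>(Y)\<close> for all local vector fields \<open>Y\<close>.\<close>

definition sharp :: "('a, 'e::euclidean_space) mfd \<Rightarrow> 'a tmetric \<Rightarrow> 'a form1 \<Rightarrow> 'a vfield" where
  "sharp M g \<alpha> = (\<lambda>p. THE v. v \<in> tangent_space M p \<and>
     (\<forall>U Y. p \<in> U \<and> smooth_vf M U Y \<longrightarrow> g p v (Y p) = \<alpha> Y p))"

definition lie_product :: "('a, 'e::euclidean_space) mfd \<Rightarrow> 'a vfield \<Rightarrow> 'a tproduct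
    \<Rightarrow> 'a vfield \<Rightarrow> 'a vfield \<Rightarrow> 'a vfield" where
  "lie_product M Z m X Y = lie_bracket M Z (vprod m X Y)
     - vprod m (lie_bracket M Z X) Y - vprod m X (lie_bracket M Z Y)"

definition lie_metric :: "('a, 'e::euclidean_space) mfd \<Rightarrow> 'a vfield \<Rightarrow> 'a tmetric
    \<Rightarrow> 'a vfield \<Rightarrow> 'a vfield \<Rightarrow> 'a \<Rightarrow> real" where
  "lie_metric M Z g X Y = (\<lambda>p. Z p (vinner g X Y)
     - vinner g (lie_bracket M Z X) Y p - vinner g X (lie_bracket M Z Y) p)"

text \<open>A connection acts on local vector fields; the second clause says that it is compatible with
  restriction to smaller open sets.\<close>

type_synonym 'a conn = "'a vfield \<Rightarrow> 'a vfield \<Rightarrow> 'a vfield"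

definition connection :: "('a, 'e::euclidean_space) mfd \<Rightarrow> 'a conn \<Rightarrow> bool" where
  "connection M D \<longleftrightarrow>
     (\<forall>U X Y. smooth_vf M U X \<and> smooth_vf M U Y \<longrightarrow> smooth_vf M U (D X Y)) \<and>
     (\<forall>U X X' Y Y'. smooth_vf M U X \<and> smooth_vf M U X' \<and> smooth_vf M U Y \<and> smooth_vf M U Y' \<and>
        (\<forall>p\<in>U. X p = X' p \<and> Y p = Y' p) \<longrightarrow> (\<forall>p\<in>U. D X Y p = D X' Y' p)) \<and>
     (\<forall>U X Y Z a. smooth_vf M U X \<and> smooth_vf M U Y \<and> smooth_vf M U Z \<and> smooth_fun M U a \<longrightarrow>
        (\<forall>p\<in>U. D (X + Y) Z p = D X Z p + D Y Z p \<and>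
               D X (Y + Z) p = D X Y p + D X Z p \<and>
               D (vscale a X) Y p = tscale (a p) (D X Y p) \<and>
               D X (vscale a Y) p = tscale (X p a) (Y p) + tscale (a p) (D X Y p)))"

definition torsionless :: "('a, 'e::euclidean_space) mfd \<Rightarrow> 'a conn \<Rightarrow> bool" where
  "torsionless M D \<longleftrightarrow> (\<forall>U X Y. smooth_vf M U X \<and> smooth_vf M U Y \<longrightarrow>
     (\<forall>p\<in>U. (D X Y - D Y X - lie_bracket M X Y) p = 0))"

definition riemann :: "('a, 'e::euclidean_space) mfd \<Rightarrow> 'a conn
    \<Rightarrow> 'a vfield \<Rightarrow> 'a vfield \<Rightarrow> 'a vfield \<Rightarrow> 'a vfield" where
  "riemann M D X Y Z = D X (D Y Z) - D Y (D X Z) - D (lie_bracket M X Y) Z"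

definition flat :: "('a, 'e::euclidean_space) mfd \<Rightarrow> 'a conn \<Rightarrow> bool" where
  "flat M D \<longleftrightarrow> (\<forall>U X Y Z. smooth_vf M U X \<and> smooth_vf M U Y \<and> smooth_vf M U Z \<longrightarrow>
     (\<forall>p\<in>U. riemann M D X Y Z p = 0))"

definition metric_connection ::
  "('a, 'e::euclidean_space) mfd \<Rightarrow> 'a tmetric \<Rightarrow> 'a conn \<Rightarrow> bool" where
  "metric_connection M g D \<longleftrightarrow>
     (\<forall>U X Y Z. smooth_vf M U X \<and> smooth_vf M U Y \<and> smooth_vf M U Z \<longrightarrow>
       (\<forall>p\<in>U. X p (vinner g Y Z) = vinner g (D X Y) Z p + vinner g Y (D X Z) p))"

text \<open>The Levi-Civita connection is given by its defining property, since its action on arguments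
  that are not smooth vector fields is arbitrary.\<close>

definition levi_civita ::
  "('a, 'e::euclidean_space) mfd \<Rightarrow> 'a tmetric \<Rightarrow> 'a conn \<Rightarrow> bool" where
  "levi_civita M g D \<longleftrightarrow> connection M D \<and> torsionless M D \<and> metric_connection M g D"

definition cov_deriv_product :: "'a conn \<Rightarrow> 'a tproduct
    \<Rightarrow> 'a vfield \<Rightarrow> 'a vfield \<Rightarrow> 'a vfield \<Rightarrow> 'a vfield" where
  "cov_deriv_product D m X Y Z = D X (vprod m Y Z) - vprod m (D X Y) Z - vprod m Y (D X Z)"

definition second_cov_deriv ::
  "'a conn \<Rightarrow> 'a vfield \<Rightarrow> 'a vfield \<Rightarrow> 'a vfield \<Rightarrow> 'a vfield" where
  "second_cov_deriv D X Y Z = D X (D Y Z) - D (D X Y) Z"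

definition F_manifold :: "('a, 'e::euclidean_space) mfd \<Rightarrow> 'a tproduct \<Rightarrow> 'a vfield \<Rightarrow> bool" where
  "F_manifold M m e \<longleftrightarrow> smooth_manifold M \<and> comm_assoc_product M m \<and> unit_field M m e \<and>
     (\<forall>U X Y Z W. smooth_vf M U X \<and> smooth_vf M U Y \<and> smooth_vf M U Z \<and> smooth_vf M U W \<longrightarrow>
       (\<forall>p\<in>U. lie_product M (vprod m X Y) m Z W p =
          vprod m X (lie_product M Y m Z W) p + vprod m Y (lie_product M X m Z W) p))"

text \<open>The quantified \<open>D\<close> below is the Levi-Civita connection of \<open>g\<close>, which exists and is unique
  (as an operator on smooth local vector fields) for every pseudo-Riemannian metric.\<close>

definition riemannian_F_manifold_Killing_unit ::
  "('a, 'e::euclidean_space) mfd \<Rightarrow> 'a tproduct \<Rightarrow> 'a tmetric \<Rightarrow> 'a vfield \<Rightarrow> bool" where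
  "riemannian_F_manifold_Killing_unit M m g e \<longleftrightarrow> F_manifold M m e \<and> pseudo_metric M g \<and>
     (\<forall>U X Y Z. smooth_vf M U X \<and> smooth_vf M U Y \<and> smooth_vf M U Z \<longrightarrow>
       (\<forall>p\<in>U. vinner g (vprod m X Y) Z p = vinner g X (vprod m Y Z) p)) \<and>
     (\<forall>D. levi_civita M g D \<longrightarrow>
       (\<forall>U X Y Z W. smooth_vf M U X \<and> smooth_vf M U Y \<and> smooth_vf M U Z \<and> smooth_vf M U W \<longrightarrow>
         (\<forall>p\<in>U. (riemann M D Y Z (vprod m X W) + riemann M D X Y (vprod m Z W)
                   + riemann M D Z X (vprod m Y W)) p = 0))) \<and>
     (\<forall>U X Y. smooth_vf M U X \<and> smooth_vf M U Y \<longrightarrow> (\<forall>p\<in>U. lie_metric M e g X Y p = 0))"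

definition homogeneous_riemannian_F_manifold_Killing_unit ::
  "('a, 'e::euclidean_space) mfd \<Rightarrow> 'a tproduct \<Rightarrow> 'a tmetric \<Rightarrow> 'a vfield \<Rightarrow> 'a vfield \<Rightarrow> bool" where
  "homogeneous_riemannian_F_manifold_Killing_unit M m g e E \<longleftrightarrow>
     riemannian_F_manifold_Killing_unit M m g e \<and> smooth_vf M (carr M) E \<and>
     (\<forall>U X Y. smooth_vf M U X \<and> smooth_vf M U Y \<longrightarrow>
       (\<forall>p\<in>U. lie_product M E m X Y p = vprod m X Y p)) \<and>
     (\<exists>d::real. \<forall>U X Y. smooth_vf M U X \<and> smooth_vf M U Y \<longrightarrow>
       (\<forall>p\<in>U. lie_metric M E g X Y p = d * vinner g X Y p))"

definition flat_F_manifold ::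
  "('a, 'e::euclidean_space) mfd \<Rightarrow> 'a tproduct \<Rightarrow> 'a conn \<Rightarrow> 'a vfield \<Rightarrow> bool" where
  "flat_F_manifold M m D e \<longleftrightarrow>
     smooth_manifold M \<and> comm_assoc_product M m \<and> unit_field M m e \<and>
     connection M D \<and> torsionless M D \<and> flat M D \<and>
     (\<forall>U X. smooth_vf M U X \<longrightarrow> (\<forall>p\<in>U. D X e p = 0)) \<and>
     (\<forall>U X Y Z. smooth_vf M U X \<and> smooth_vf M U Y \<and> smooth_vf M U Z \<longrightarrow>
       (\<forall>p\<in>U. cov_deriv_product D m X Y Z p = cov_deriv_product D m Y X Z p \<and>
              cov_deriv_product D m X Y Z p = cov_deriv_product D m X Z Y p))"

definition homogeneous_flat_F_manifold ::
  "('a, 'e::euclidean_space) mfd \<Rightarrow> 'a tproduct \<Rightarrow> 'a conn \<Rightarrow> 'a vfield \<Rightarrow> 'a vfield \<Rightarrow> bool" where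
  "homogeneous_flat_F_manifold M m D e E \<longleftrightarrow> flat_F_manifold M m D e \<and> smooth_vf M (carr M) E \<and>
     (\<forall>U X Y. smooth_vf M U X \<and> smooth_vf M U Y \<longrightarrow>
       (\<forall>p\<in>U. lie_product M E m X Y p = vprod m X Y p)) \<and>
     (\<forall>U X Y. smooth_vf M U X \<and> smooth_vf M U Y \<longrightarrow> (\<forall>p\<in>U. second_cov_deriv D X Y E p = 0))"

end

theory Submission
  imports Defs
begin

text \<open>
Write \<open>D\<close> for the Levi-Civita connection and \<open>A X = D\<^sub>X e\<close>.  Since \<open>e\<close> is a Killing field, \<open>A\<close> is
skew for \<open>g\<close>, and \<open>d\<theta>(X, Y) = g(A X, Y) - g(A Y, X) = 2 g(A X, Y)\<close>; so
\<open>(\<iota>\<^sub>X d\<theta>)\<^sup>\<sharp> = 2 A X\<close> and the connection of the theorem is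
\<open>\<nabla>\<^sub>X Y = D\<^sub>X Y - A(X \<circ> Y)\<close> (\<open>sharp_ext_deriv\<close>, \<open>nabla_LC\<close>).  In this form it is visibly
torsionless, and \<open>\<nabla>\<^sub>X e = A X - A X = 0\<close>.  The other properties come from three computations.

Compatibility.  Let \<open>c\<close> be the product viewed as a tensor.  Written with \<open>D\<close>, the defining identity
of an F-manifold is linear in \<open>Dc\<close>.  Its pairing with \<open>e\<close> only involves the four numbers
\<open>F\<^sub>X = g((D\<^sub>X c)(Y, Z), W)\<close>, \<open>F\<^sub>Y\<close>, \<open>F\<^sub>Z\<close>, \<open>F\<^sub>W\<close>, obtained by letting each of the four fields
in turn be the direction of differentiation, and it reads
\<open>F\<^sub>X + F\<^sub>Y - F\<^sub>Z - F\<^sub>W = 2 g(A(Z \<circ> W), X \<circ> Y)\<close>.  Two permutations of this equation determine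
\<open>F\<^sub>X - F\<^sub>Y\<close>, and this says that the failure of \<open>(D\<^sub>X c)(Y, Z)\<close> to be symmetric in \<open>X\<close> and \<open>Y\<close> is
\<open>X \<circ> A(Y \<circ> Z) - Y \<circ> A(X \<circ> Z)\<close> (\<open>dmul_exchange\<close>), which is what the correction term of \<open>\<nabla>\<close>
cancels.

Flatness.  A field whose flow preserves \<open>g\<close> up to a constant factor also preserves \<open>D\<close>
(\<open>homothetic_imp_affine_field\<close>), and for a field preserving a torsionless connection the second covariant
derivative is a curvature term (\<open>second_deriv_affine_field\<close>); for \<open>e\<close> this gives
\<open>(D\<^sub>X A) Y = - R(e, X) Y\<close>.  The curvature condition with one argument equal to \<open>e\<close> expresses the
whole curvature \<open>R(X, Y) Z\<close> by terms \<open>R(e, \<cdot>)\<close> and hence by \<open>DA\<close>.  In the expansion of the curvature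
of \<open>\<nabla>\<close> these terms cancel, and what remains is \<open>A\<close> applied to the identity of \<open>dmul_exchange\<close>.

Euler field.  By homogeneity \<open>E\<close> preserves \<open>D\<close>, and \<open>[E, e] = - e\<close>.  So the Lie derivative
along \<open>E\<close> multiplies \<open>A\<close> by \<open>-1\<close> and the product by \<open>1\<close>; the tensor \<open>A(X \<circ> Y)\<close>, and with it
\<open>\<nabla>\<close>, is preserved.  For a flat torsionless connection \<open>second_deriv_affine_field\<close> turns this
into \<open>\<nabla>\<nabla>E = 0\<close>.

These are computations with the Lie bracket, the connection, the product, the metric and the action of
fields on functions, and they are made in abstract additive groups with these operations.
The operations on vector fields satisfy the abstract laws as equations between functions once all fields are set
to zero outside a fixed open set \<open>V\<close>.  Nondegeneracy of the metric on fields needs every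
tangent vector at a point of \<open>V\<close> to extend to a smooth field on \<open>V\<close>; this holds when \<open>V\<close> lies in the domain of a
chart, by means of the coordinate fields, whose smoothness is a chain rule for \<open>C\<^sup>k\<close> functions.  All properties to be
shown are pointwise, so it is enough to look at such small \<open>V\<close>.
\<close>

section \<open>Algebra of torsionless connections and metrics\<close>

text \<open>The abstract counterpart of the additive group of vector fields over an open set, with a torsionless
connection \<open>D\<close> and the Lie bracket \<open>br\<close>.\<close>

locale torsionless_module =
  fixes V :: "'v::ab_group_add set"
    and br :: "'v \<Rightarrow> 'v \<Rightarrow> 'v"
    and D :: "'v \<Rightarrow> 'v \<Rightarrow> 'v"
  assumes D_closed [simp]: "X \<in> V \<Longrightarrow> Y \<in> V \<Longrightarrow> D X Y \<in> V"
    and diff_closed [simp]: "X \<in> V \<Longrightarrow> Y \<in> V \<Longrightarrow> X - Y \<in> V"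
    and D_add_left: "X \<in> V \<Longrightarrow> Y \<in> V \<Longrightarrow> Z \<in> V \<Longrightarrow> D (X + Y) Z = D X Z + D Y Z"
    and D_add_right: "X \<in> V \<Longrightarrow> Y \<in> V \<Longrightarrow> Z \<in> V \<Longrightarrow> D X (Y + Z) = D X Y + D X Z"
    and br_torsion: "X \<in> V \<Longrightarrow> Y \<in> V \<Longrightarrow> br X Y = D X Y - D Y X"
begin

definition curv :: "'v \<Rightarrow> 'v \<Rightarrow> 'v \<Rightarrow> 'v" where
  "curv X Y Z = D X (D Y Z) - D Y (D X Z) - D (br X Y) Z"

text \<open>The flow of \<open>E\<close> preserves the connection, expressed infinitesimally.\<close>

definition affine_field :: "'v \<Rightarrow> bool" where
  "affine_field E \<longleftrightarrow> (\<forall>X\<in>V. \<forall>Y\<in>V. br E (D X Y) = D (br E X) Y + D X (br E Y))"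

lemma br_closed [simp]: "X \<in> V \<Longrightarrow> Y \<in> V \<Longrightarrow> br X Y \<in> V"
  by (simp add: br_torsion)

lemma zero_closed: "X \<in> V \<Longrightarrow> 0 \<in> V"
  using diff_closed[of X X] by simp

lemma add_closed [simp]: "X \<in> V \<Longrightarrow> Y \<in> V \<Longrightarrow> X + Y \<in> V"
  using diff_closed[OF _ diff_closed[OF zero_closed], of X Y Y] by simp

lemma D_diff_left: "X \<in> V \<Longrightarrow> Y \<in> V \<Longrightarrow> Z \<in> V \<Longrightarrow> D (X - Y) Z = D X Z - D Y Z"
  using D_add_left[of "X - Y" Y Z] by (simp add: algebra_simps)

lemma D_diff_right: "X \<in> V \<Longrightarrow> Y \<in> V \<Longrightarrow> Z \<in> V \<Longrightarrow> D X (Y - Z) = D X Y - D X Z"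
  using D_add_right[of X "Y - Z" Z] by (simp add: algebra_simps)

lemma D_minus_right: "X \<in> V \<Longrightarrow> Y \<in> V \<Longrightarrow> D X (- Y) = - D X Y"
  using D_diff_right[of X "0" Y] D_diff_right[of X Y Y] zero_closed by (simp)

text \<open>Replacing the outer bracket \<open>[E, S]\<close> by \<open>D\<^sub>E S - D\<^sub>S E\<close> in the condition for affine fields
leaves exactly the second derivative of \<open>E\<close> and the curvature.\<close>

lemma second_deriv_affine_field:
  assumes "affine_field E" "E \<in> V" "X \<in> V" "Y \<in> V"
  shows "D X (D Y E) - D (D X Y) E = - curv E X Y"
proof -
  have "D E (D X Y) - D (D X Y) E = D (br E X) Y + D X (D E Y - D Y E)"
    using assms br_torsion unfolding affine_field_def by (metis D_closed)
  then show ?thesis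
    using assms by (simp add: curv_def D_diff_right algebra_simps)
qed

end

text \<open>Here \<open>F\<close> stands for the smooth functions on the open set and \<open>act X f\<close> for the derivative of \<open>f\<close>
along \<open>X\<close>.  Functions are concrete real functions so that linear arithmetic applies at each point.\<close>

locale metric_module = torsionless_module V br D
  for V :: "'v::ab_group_add set" and br D +
  fixes F :: "('a \<Rightarrow> real) set"
    and act :: "'v \<Rightarrow> ('a \<Rightarrow> real) \<Rightarrow> 'a \<Rightarrow> real"
    and g :: "'v \<Rightarrow> 'v \<Rightarrow> 'a \<Rightarrow> real"
  assumes jacobi: "X \<in> V \<Longrightarrow> Y \<in> V \<Longrightarrow> Z \<in> V \<Longrightarrow>
        br X (br Y Z) = br (br X Y) Z + br Y (br X Z)"
    and g_closed [simp]: "X \<in> V \<Longrightarrow> Y \<in> V \<Longrightarrow> g X Y \<in> F"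
    and F_add [simp]: "f \<in> F \<Longrightarrow> h \<in> F \<Longrightarrow> f + h \<in> F"
    and F_scale [simp]: "f \<in> F \<Longrightarrow> (\<lambda>p. c * f p) \<in> F"
    and act_add: "X \<in> V \<Longrightarrow> f \<in> F \<Longrightarrow> h \<in> F \<Longrightarrow> act X (f + h) = act X f + act X h"
    and act_scale: "X \<in> V \<Longrightarrow> f \<in> F \<Longrightarrow> act X (\<lambda>p. c * f p) = (\<lambda>p. c * act X f p)"
    and act_br: "X \<in> V \<Longrightarrow> Y \<in> V \<Longrightarrow> f \<in> F \<Longrightarrow>
        act (br X Y) f = act X (act Y f) - act Y (act X f)"
    and g_commute: "X \<in> V \<Longrightarrow> Y \<in> V \<Longrightarrow> g X Y = g Y X"
    and g_add_left: "X \<in> V \<Longrightarrow> Y \<in> V \<Longrightarrow> Z \<in> V \<Longrightarrow> g (X + Y) Z = g X Z + g Y Z"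
    and g_nondegenerate: "X \<in> V \<Longrightarrow> (\<And>Z p. Z \<in> V \<Longrightarrow> g X Z p = 0) \<Longrightarrow> X = 0"
    and metric: "X \<in> V \<Longrightarrow> Y \<in> V \<Longrightarrow> Z \<in> V \<Longrightarrow>
        act X (g Y Z) = g (D X Y) Z + g Y (D X Z)"
begin

text \<open>This is \<open>\<L>\<^sub>E g = c g\<close>; the case \<open>c = 0\<close> is the Killing equation.\<close>

definition homothetic :: "real \<Rightarrow> 'v \<Rightarrow> bool" where
  "homothetic c E \<longleftrightarrow> (\<forall>Y\<in>V. \<forall>Z\<in>V.
     act E (g Y Z) = (\<lambda>p. c * g Y Z p) + (g (br E Y) Z + g Y (br E Z)))"

lemma g_diff_left: "X \<in> V \<Longrightarrow> Y \<in> V \<Longrightarrow> Z \<in> V \<Longrightarrow> g (X - Y) Z = g X Z - g Y Z"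
  using g_add_left[of "X - Y" Y Z] by (simp add: algebra_simps)

lemma g_add_right: "X \<in> V \<Longrightarrow> Y \<in> V \<Longrightarrow> Z \<in> V \<Longrightarrow> g X (Y + Z) = g X Y + g X Z"
  using g_add_left[of Y Z X] g_commute by simp

lemma g_diff_right: "X \<in> V \<Longrightarrow> Y \<in> V \<Longrightarrow> Z \<in> V \<Longrightarrow> g X (Y - Z) = g X Y - g X Z"
  using g_diff_left[of Y Z X] g_commute by simp

text \<open>The defect \<open>K\<close> of \<open>E\<close> being affine is symmetric, because \<open>D\<close> is torsionless and the bracket
satisfies the Jacobi identity, and \<open>g(K(X, Y), Z)\<close> is skew in \<open>Y, Z\<close>, because \<open>D\<close> is metric and
\<open>E\<close> scales the metric by a constant.  A trilinear form that is symmetric in the first two and skew in the last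
two arguments vanishes.\<close>

lemma homothetic_imp_affine_field:
  assumes E: "E \<in> V" and hom: "homothetic c E"
  shows "affine_field E"
proof -
  define K where "K X Y = br E (D X Y) - D (br E X) Y - D X (br E Y)" for X Y
  have K_closed: "K X Y \<in> V" if "X \<in> V" "Y \<in> V" for X Y
    using that E by (simp add: K_def)
  have sym: "K X Y = K Y X" if XY: "X \<in> V" "Y \<in> V" for X Y
    using jacobi[OF E XY] XY E
    by (simp add: K_def br_torsion D_diff_left D_diff_right algebra_simps)
  have skew: "g (K X Y) Z p + g Y (K X Z) p = 0"
    if XYZ: "X \<in> V" "Y \<in> V" "Z \<in> V" for X Y Z p
  proof -
    have LE: "act E (g Y Z) = (\<lambda>p. c * g Y Z p) + (g (br E Y) Z + g Y (br E Z))"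
      if "Y \<in> V" "Z \<in> V" for Y Z
      using hom that by (simp add: homothetic_def)
    have 1: "act E (act X (g Y Z)) p
        = c * g (D X Y) Z p + g (br E (D X Y)) Z p + g (D X Y) (br E Z) p
          + (c * g Y (D X Z) p + g (br E Y) (D X Z) p + g Y (br E (D X Z)) p)"
      using XYZ E by (simp add: metric[of X] act_add LE)
    have 2: "act X (act E (g Y Z)) p
        = c * (g (D X Y) Z p + g Y (D X Z) p) + (g (D X (br E Y)) Z p + g (br E Y) (D X Z) p)
          + (g (D X Y) (br E Z) p + g Y (D X (br E Z)) p)"
      using XYZ E by (simp add: metric[of X] act_add act_scale LE)
    have "g (D (br E X) Y) Z p + g Y (D (br E X) Z) p
        = act E (act X (g Y Z)) p - act X (act E (g Y Z)) p"
      using XYZ E fun_cong[OF metric[of "br E X" Y Z], of p] fun_cong[OF act_br[of E X "g Y Z"], of p]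
      by simp
    then show ?thesis
      unfolding 1 2 using XYZ E by (simp add: K_def g_diff_left g_diff_right g_add_left g_add_right algebra_simps)
  qed
  have "K X Y = 0" if XY: "X \<in> V" "Y \<in> V" for X Y
  proof (rule g_nondegenerate[OF K_closed[OF XY]])
    fix Z p assume Z: "Z \<in> V"
    note cl = XY Z K_closed
    \<comment> \<open>Alternating the two symmetries three times returns to the same value with opposite sign.\<close>
    show "g (K X Y) Z p = 0"
      using skew[of X Y Z p] skew[of Y Z X p] skew[of Z X Y p] cl
        g_commute[of Y "K X Z"] g_commute[of Z "K X Y"] g_commute[of X "K Y Z"]
        g_commute[of Z "K Y X"] g_commute[of Y "K Z X"] g_commute[of X "K Z Y"]
        sym[of X Y] sym[of X Z] sym[of Y Z]
      by simp
  qed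
  then show ?thesis
    by (simp add: affine_field_def K_def algebra_simps)
qed

end

section \<open>Algebra of F-manifolds with Killing unit\<close>

locale F_module = metric_module V br D F act g
  for V :: "'v::ab_group_add set" and br D F and act :: "'v \<Rightarrow> ('a \<Rightarrow> real) \<Rightarrow> 'a \<Rightarrow> real" and g +
  fixes mul :: "'v \<Rightarrow> 'v \<Rightarrow> 'v" (infixl \<open>\<diamondop>\<close> 70)
    and e :: 'v
  assumes mul_closed [simp]: "X \<in> V \<Longrightarrow> Y \<in> V \<Longrightarrow> X \<diamondop> Y \<in> V"
    and mul_commute: "X \<in> V \<Longrightarrow> Y \<in> V \<Longrightarrow> X \<diamondop> Y = Y \<diamondop> X"
    and mul_assoc: "X \<in> V \<Longrightarrow> Y \<in> V \<Longrightarrow> Z \<in> V \<Longrightarrow> X \<diamondop> Y \<diamondop> Z = X \<diamondop> (Y \<diamondop> Z)"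
    and mul_add_left: "X \<in> V \<Longrightarrow> Y \<in> V \<Longrightarrow> Z \<in> V \<Longrightarrow> (X + Y) \<diamondop> Z = X \<diamondop> Z + Y \<diamondop> Z"
    and unit_closed [simp]: "e \<in> V"
    and unit_left [simp]: "X \<in> V \<Longrightarrow> e \<diamondop> X = X"
    and g_invariant: "X \<in> V \<Longrightarrow> Y \<in> V \<Longrightarrow> Z \<in> V \<Longrightarrow> g (X \<diamondop> Y) Z = g X (Y \<diamondop> Z)"
    and Hertling_Manin: "X \<in> V \<Longrightarrow> Y \<in> V \<Longrightarrow> Z \<in> V \<Longrightarrow> W \<in> V \<Longrightarrow>
        br (X \<diamondop> Y) (Z \<diamondop> W) - br (X \<diamondop> Y) Z \<diamondop> W - Z \<diamondop> br (X \<diamondop> Y) W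
        = X \<diamondop> (br Y (Z \<diamondop> W) - br Y Z \<diamondop> W - Z \<diamondop> br Y W)
          + Y \<diamondop> (br X (Z \<diamondop> W) - br X Z \<diamondop> W - Z \<diamondop> br X W)"
    and curv_mul: "X \<in> V \<Longrightarrow> Y \<in> V \<Longrightarrow> Z \<in> V \<Longrightarrow> W \<in> V \<Longrightarrow>
        curv Y Z (X \<diamondop> W) + curv X Y (Z \<diamondop> W) + curv Z X (Y \<diamondop> W) = 0"
    and unit_Killing: "homothetic 0 e"
begin

text \<open>The connection of the theorem, in the form \<open>D\<^sub>X Y - A(X \<circ> Y)\<close> with \<open>A X = D\<^sub>X e\<close>.\<close>

definition nab :: "'v \<Rightarrow> 'v \<Rightarrow> 'v" where
  "nab X Y = D X Y - D (X \<diamondop> Y) e"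

text \<open>The value \<open>(D\<^sub>X c)(Y, Z)\<close> of the covariant derivative of the product \<open>c\<close>.\<close>

definition dmul :: "'v \<Rightarrow> 'v \<Rightarrow> 'v \<Rightarrow> 'v" where
  "dmul X Y Z = D X (Y \<diamondop> Z) - D X Y \<diamondop> Z - Y \<diamondop> D X Z"

lemma mul_left_commute: "X \<in> V \<Longrightarrow> Y \<in> V \<Longrightarrow> Z \<in> V \<Longrightarrow> X \<diamondop> (Y \<diamondop> Z) = Y \<diamondop> (X \<diamondop> Z)"
  by (metis mul_assoc mul_commute)

lemma unit_right [simp]: "X \<in> V \<Longrightarrow> X \<diamondop> e = X"
  by (metis mul_commute unit_closed unit_left)

lemma mul_add_right: "X \<in> V \<Longrightarrow> Y \<in> V \<Longrightarrow> Z \<in> V \<Longrightarrow> X \<diamondop> (Y + Z) = X \<diamondop> Y + X \<diamondop> Z"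
  by (simp add: mul_commute[of X] mul_add_left)

lemma mul_diff_left: "X \<in> V \<Longrightarrow> Y \<in> V \<Longrightarrow> Z \<in> V \<Longrightarrow> (X - Y) \<diamondop> Z = X \<diamondop> Z - Y \<diamondop> Z"
  using mul_add_left[of "X - Y" Y Z] by (simp add: algebra_simps)

lemma mul_diff_right: "X \<in> V \<Longrightarrow> Y \<in> V \<Longrightarrow> Z \<in> V \<Longrightarrow> X \<diamondop> (Y - Z) = X \<diamondop> Y - X \<diamondop> Z"
  by (simp add: mul_commute[of X] mul_diff_left)

lemma dmul_closed [simp]: "X \<in> V \<Longrightarrow> Y \<in> V \<Longrightarrow> Z \<in> V \<Longrightarrow> dmul X Y Z \<in> V"
  by (simp add: dmul_def)

lemma dmul_commute: "X \<in> V \<Longrightarrow> Y \<in> V \<Longrightarrow> Z \<in> V \<Longrightarrow> dmul X Y Z = dmul X Z Y"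
  by (simp add: dmul_def mul_commute algebra_simps)

lemma dmul_unit: "X \<in> V \<Longrightarrow> Y \<in> V \<Longrightarrow> dmul X Y e = - (Y \<diamondop> D X e)"
  by (simp add: dmul_def)

text \<open>The form \<open>g(Y \<circ> Z, W)\<close> is totally symmetric by invariance of \<open>g\<close>, and since \<open>g\<close> is parallel so is
its covariant derivative.\<close>

lemma g_dmul_symmetric:
  assumes "X \<in> V" "Y \<in> V" "Z \<in> V" "W \<in> V"
  shows "g (dmul X Y Z) W = g (dmul X Y W) Z"
proof -
  have 1: "act X (g (Y \<diamondop> Z) W) = g (D X (Y \<diamondop> Z)) W + g (Y \<diamondop> Z) (D X W)"
    using assms by (simp add: metric)
  have 2: "act X (g Z (Y \<diamondop> W)) = g (D X Z) (Y \<diamondop> W) + g Z (D X (Y \<diamondop> W))"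
    using assms by (simp add: metric)
  have 0: "g (Y \<diamondop> Z) W = g Z (Y \<diamondop> W)" if "Y \<in> V" "Z \<in> V" "W \<in> V" for Y Z W
    using that by (metis g_invariant mul_commute)
  have "g (D X (Y \<diamondop> Z)) W + g Z (Y \<diamondop> D X W) = g (D X Z) (Y \<diamondop> W) + g Z (D X (Y \<diamondop> W))"
    using 1 2 0[of Y Z W] 0[of Y Z "D X W"] assms by simp
  then show ?thesis
    using assms 0[of "D X Y" Z W] 0[of Y "D X Z" W] g_commute[of Z "Y \<diamondop> D X W"]
       g_commute[of Z "D X (Y \<diamondop> W)"] g_commute[of Z "D X Y \<diamondop> W"]
    by (simp add: dmul_def g_diff_left g_add_left algebra_simps)
qed

lemma Killing_skew:
  assumes "X \<in> V" "Y \<in> V"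
  shows "g (D X e) Y p = - g (D Y e) X p"
proof -
  have "act e (g X Y) p = g (br e X) Y p + g X (br e Y) p"
    using unit_Killing assms by (simp add: homothetic_def)
  moreover have "act e (g X Y) p = g (D e X) Y p + g X (D e Y) p"
    using metric[of e X Y] assms by simp
  ultimately show ?thesis
    using assms g_commute[of X "D Y e"] by (simp add: br_torsion g_diff_left g_diff_right)
qed

text \<open>The Lie derivative of the product along \<open>X\<close>, expressed by the torsionless connection.\<close>

lemma lie_derivative_mul:
  assumes "X \<in> V" "Z \<in> V" "W \<in> V"
  shows "br X (Z \<diamondop> W) - br X Z \<diamondop> W - Z \<diamondop> br X W
    = dmul X Z W - D (Z \<diamondop> W) X + W \<diamondop> D Z X + Z \<diamondop> D W X"
  using assms
  by (simp add: dmul_def br_torsion mul_diff_left mul_diff_right mul_commute[of "D Z X"])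

text \<open>The left side is \<open>d\<theta>(X, Y)\<close> for the one-form \<open>\<theta> = g(e, \<cdot>)\<close>.  The terms that differentiate
\<open>X\<close> and \<open>Y\<close> cancel against the bracket, and skewness of \<open>De\<close> makes the other two equal.\<close>

lemma ext_deriv_dual_unit:
  assumes "X \<in> V" "Y \<in> V"
  shows "act X (g e Y) p - act Y (g e X) p - g e (br X Y) p = 2 * g (D X e) Y p"
  using assms Killing_skew[OF assms]
  by (simp add: metric br_torsion g_diff_right)

text \<open>In the F-manifold identity, written by \<open>lie_derivative_mul\<close>, all terms with derivatives of the four fields
cancel.\<close>

lemma Hertling_Manin_dmul:
  assumes XYZW: "X \<in> V" "Y \<in> V" "Z \<in> V" "W \<in> V"
  shows "dmul (X \<diamondop> Y) Z W - dmul (Z \<diamondop> W) X Y + W \<diamondop> dmul Z X Y + Z \<diamondop> dmul W X Y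
    = X \<diamondop> dmul Y Z W + Y \<diamondop> dmul X Z W"
proof -
  have Leibniz: "D S (X \<diamondop> Y) = dmul S X Y + Y \<diamondop> D S X + X \<diamondop> D S Y" if "S \<in> V" for S
    using that XYZW by (simp add: dmul_def mul_commute[of _ Y])
  have "dmul (X \<diamondop> Y) Z W - D (Z \<diamondop> W) (X \<diamondop> Y) + W \<diamondop> D Z (X \<diamondop> Y) + Z \<diamondop> D W (X \<diamondop> Y)
      = X \<diamondop> (dmul Y Z W - D (Z \<diamondop> W) Y + W \<diamondop> D Z Y + Z \<diamondop> D W Y)
        + Y \<diamondop> (dmul X Z W - D (Z \<diamondop> W) X + W \<diamondop> D Z X + Z \<diamondop> D W X)"
    using Hertling_Manin[OF XYZW] XYZW by (simp only: lie_derivative_mul mul_closed)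
  then show ?thesis
    using XYZW
    by (simp add: Leibniz mul_add_right mul_diff_right mul_left_commute[of W X]
        mul_left_commute[of W Y] mul_left_commute[of Z X] mul_left_commute[of Z Y] algebra_simps)
qed

text \<open>The pairing of \<open>Hertling_Manin_dmul\<close> with the unit.  For the two terms differentiated along a product,
total symmetry moves the unit into the product, where \<open>dmul_unit\<close> evaluates them; skewness of \<open>De\<close>
makes their contributions equal, whence the factor 2.\<close>

lemma dmul_two_pairs:
  assumes XYZW: "X \<in> V" "Y \<in> V" "Z \<in> V" "W \<in> V"
  shows "g (dmul X Y Z) W p + g (dmul Y X Z) W p - g (dmul Z X Y) W p - g (dmul W X Y) Z p
    = 2 * g (D (Z \<diamondop> W) e) (X \<diamondop> Y) p"
proof -
  have pair_unit: "g (A \<diamondop> B) e = g B A" if "A \<in> V" "B \<in> V" for A B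
    using that g_invariant[of A B e] g_commute[of A B] by simp
  have dmul_pair_unit: "g (dmul S A B) e = - g (D S e) (A \<diamondop> B)"
    if SAB: "S \<in> V" "A \<in> V" "B \<in> V" for S A B
  proof -
    have "g (dmul S A B) e = g (- (A \<diamondop> D S e)) B"
      using SAB g_dmul_symmetric[of S A B e] by (simp add: dmul_unit)
    also have "\<dots> = - g (D S e) (A \<diamondop> B)"
      using SAB g_diff_left[of 0 "A \<diamondop> D S e" B] g_diff_left[of 0 0 B] zero_closed
        g_invariant[of "D S e" A B] mul_commute[of A "D S e"] by simp
    finally show ?thesis .
  qed
  have "g (dmul (X \<diamondop> Y) Z W) e - g (dmul (Z \<diamondop> W) X Y) e
      + g (W \<diamondop> dmul Z X Y) e + g (Z \<diamondop> dmul W X Y) e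
      = g (X \<diamondop> dmul Y Z W) e + g (Y \<diamondop> dmul X Z W) e"
    using arg_cong[OF Hertling_Manin_dmul[OF XYZW], of "\<lambda>T. g T e"] XYZW
    by (simp add: g_diff_left g_add_left)
  then have "- g (D (X \<diamondop> Y) e) (Z \<diamondop> W) p + g (D (Z \<diamondop> W) e) (X \<diamondop> Y) p
      + g (dmul Z X Y) W p + g (dmul W X Y) Z p = g (dmul Y Z W) X p + g (dmul X Z W) Y p"
    using XYZW by (simp add: pair_unit dmul_pair_unit fun_eq_iff)
  moreover have "g (D (X \<diamondop> Y) e) (Z \<diamondop> W) p = - g (D (Z \<diamondop> W) e) (X \<diamondop> Y) p"
    using XYZW by (intro Killing_skew) simp_all
  moreover have "g (dmul Y Z W) X = g (dmul Y X Z) W" "g (dmul X Z W) Y = g (dmul X Y Z) W"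
    using XYZW by (simp_all add: g_dmul_symmetric[of Y Z W X] dmul_commute[of Y Z X]
        g_dmul_symmetric[of X Z W Y] dmul_commute[of X Z Y])
  ultimately show ?thesis
    by simp
qed

text \<open>The sum \<open>F\<^sub>X + F\<^sub>Z - F\<^sub>Y - F\<^sub>W\<close> and the sum \<open>F\<^sub>Y + F\<^sub>Z - F\<^sub>X - F\<^sub>W\<close> are both known from
\<open>dmul_two_pairs\<close>, and their difference is \<open>2 (F\<^sub>X - F\<^sub>Y)\<close>.\<close>

lemma dmul_exchange:
  assumes XYZ: "X \<in> V" "Y \<in> V" "Z \<in> V"
  shows "dmul X Y Z - dmul Y X Z = X \<diamondop> D (Y \<diamondop> Z) e - Y \<diamondop> D (X \<diamondop> Z) e"
proof -
  have "dmul X Y Z - dmul Y X Z - (X \<diamondop> D (Y \<diamondop> Z) e - Y \<diamondop> D (X \<diamondop> Z) e) = 0"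
  proof (rule g_nondegenerate)
    fix W p assume W: "W \<in> V"
    have "g (dmul X Y Z) W p + g (dmul Z Y X) W p - g (dmul Y X Z) W p - g (dmul W X Y) Z p
        = 2 * g (D (Y \<diamondop> W) e) (X \<diamondop> Z) p"
      using dmul_two_pairs[of X Z Y W p] XYZ W
      by (simp add: dmul_commute[of X Z Y] dmul_commute[of Z X Y] g_dmul_symmetric[of W X Z Y]
)
    moreover have "g (dmul Y X Z) W p + g (dmul Z Y X) W p - g (dmul X Y Z) W p - g (dmul W X Y) Z p
        = 2 * g (D (X \<diamondop> W) e) (Y \<diamondop> Z) p"
      using dmul_two_pairs[of Y Z X W p] XYZ W
      by (simp add: dmul_commute[of Y Z X] g_dmul_symmetric[of W Y Z X] dmul_commute[of W Y X])
    ultimately have "g (dmul X Y Z) W p - g (dmul Y X Z) W p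
        = g (D (Y \<diamondop> W) e) (X \<diamondop> Z) p - g (D (X \<diamondop> W) e) (Y \<diamondop> Z) p"
      by simp
    moreover have "g (X \<diamondop> D (Y \<diamondop> Z) e) W p = - g (D (X \<diamondop> W) e) (Y \<diamondop> Z) p"
      "g (Y \<diamondop> D (X \<diamondop> Z) e) W p = - g (D (Y \<diamondop> W) e) (X \<diamondop> Z) p"
      using XYZ W Killing_skew[of "Y \<diamondop> Z" "X \<diamondop> W" p] Killing_skew[of "X \<diamondop> Z" "Y \<diamondop> W" p]
      by (simp_all add: mul_commute[of _ "D _ e"] g_invariant)
    ultimately show "g (dmul X Y Z - dmul Y X Z - (X \<diamondop> D (Y \<diamondop> Z) e - Y \<diamondop> D (X \<diamondop> Z) e)) W p = 0"
      using XYZ W by (simp add: g_diff_left)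
  qed (use XYZ in simp)
  then show ?thesis
    by simp
qed

lemma torsionless_nab: "torsionless_module V br nab"
proof
  show "br X Y = nab X Y - nab Y X" if "X \<in> V" "Y \<in> V" for X Y
    unfolding nab_def mul_commute[OF that] using that by (simp add: br_torsion)
qed (simp_all add: nab_def D_add_left D_add_right mul_add_left mul_add_right)

sublocale nab: torsionless_module V br nab
  by (rule torsionless_nab)

lemma nab_unit: "X \<in> V \<Longrightarrow> nab X e = 0"
  by (simp add: nab_def)

text \<open>Symmetry of the covariant derivative of the product with respect to the new connection: its correction
term contributes just the negative of the right side of \<open>dmul_exchange\<close>.\<close>

lemma nab_mul_exchange:
  assumes "X \<in> V" "Y \<in> V" "Z \<in> V"
  shows "nab X (Y \<diamondop> Z) - nab X Y \<diamondop> Z - Y \<diamondop> nab X Z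
    = nab Y (X \<diamondop> Z) - nab Y X \<diamondop> Z - X \<diamondop> nab Y Z"
proof -
  have "nab X (Y \<diamondop> Z) - nab X Y \<diamondop> Z - Y \<diamondop> nab X Z
     = dmul X Y Z - D (X \<diamondop> (Y \<diamondop> Z)) e + D (X \<diamondop> Y) e \<diamondop> Z + Y \<diamondop> D (X \<diamondop> Z) e"
    if "X \<in> V" "Y \<in> V" "Z \<in> V" for X Y Z
    using that by (simp add: nab_def dmul_def mul_diff_left mul_diff_right algebra_simps)
  note nab_mul = this
  show ?thesis
    using dmul_exchange[OF assms]
    unfolding nab_mul[OF assms] nab_mul[OF assms(2,1,3)] mul_left_commute[OF assms]
      mul_commute[OF assms(1,2)]
    by (simp add: algebra_simps)
qed

lemma nab_mul_commute:
  assumes "X \<in> V" "Y \<in> V" "Z \<in> V"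
  shows "nab X (Y \<diamondop> Z) - nab X Y \<diamondop> Z - Y \<diamondop> nab X Z
    = nab X (Z \<diamondop> Y) - nab X Z \<diamondop> Y - Z \<diamondop> nab X Y"
  using assms by (simp add: mul_commute[of Z Y] mul_commute[of "nab X Y"] mul_commute[of "nab X Z"])

lemma unit_affine_field: "affine_field e"
  by (rule homothetic_imp_affine_field[OF unit_closed unit_Killing])

lemma curv_skew: "X \<in> V \<Longrightarrow> Y \<in> V \<Longrightarrow> Z \<in> V \<Longrightarrow> curv X Y Z = - curv Y X Z"
  by (simp add: curv_def br_torsion D_diff_left)

text \<open>The curvature condition with one argument equal to the unit: the curvature is determined by its
contractions with \<open>e\<close>.\<close>

lemma curv_unit:
  assumes "X \<in> V" "Y \<in> V" "Z \<in> V"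
  shows "curv X Y Z = curv e Y (X \<diamondop> Z) - curv e X (Y \<diamondop> Z)"
  using curv_mul[of e X Y Z] curv_skew[of Y e "X \<diamondop> Z"] assms
  by (simp add: algebra_simps)

lemma nab_flat:
  assumes XYZ: "X \<in> V" "Y \<in> V" "Z \<in> V"
  shows "nab.curv X Y Z = 0"
proof -
  have D_mul: "D X (Y \<diamondop> Z) = dmul X Y Z + D X Y \<diamondop> Z + Y \<diamondop> D X Z"
    for X Y Z by (simp add: dmul_def)
  have second: "D X (D S e) = D (D X S) e - curv e X S" if "X \<in> V" "S \<in> V" for X S
    using second_deriv_affine_field[OF unit_affine_field, of X S] that by (simp add: algebra_simps)
  \<comment> \<open>Second derivatives of \<open>e\<close> are replaced by curvature terms, so that each remaining occurrence of
    \<open>e\<close> is a first derivative.\<close>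
  have expand: "nab X (nab Y Z) = D X (D Y Z) - D (dmul X Y Z + D X Y \<diamondop> Z + Y \<diamondop> D X Z) e
      + curv e X (Y \<diamondop> Z) - D (X \<diamondop> D Y Z) e + D (X \<diamondop> D (Y \<diamondop> Z) e) e"
    if "X \<in> V" "Y \<in> V" "Z \<in> V" for X Y Z
    using that
    by (simp add: nab_def D_diff_right D_diff_left mul_diff_right second D_mul algebra_simps)
  have "D (dmul X Y Z - dmul Y X Z) e = D (X \<diamondop> D (Y \<diamondop> Z) e - Y \<diamondop> D (X \<diamondop> Z) e) e"
    using dmul_exchange[OF XYZ] by simp
  then show ?thesis
    using XYZ curv_unit[OF XYZ]
    by (simp add: nab.curv_def curv_def expand nab_def[of "D X Y - D Y X"] br_torsion D_diff_left
        D_add_left mul_diff_left algebra_simps)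
qed

text \<open>The new connection is built from \<open>D\<close>, the product and \<open>e\<close>, which the Euler field scales with
weights 0, 1 and -1; hence the Euler field is affine for it.\<close>

lemma nab_nab_Euler:
  assumes E: "E \<in> V" and hom: "homothetic c E"
    and scale: "\<And>X Y. X \<in> V \<Longrightarrow> Y \<in> V \<Longrightarrow>
      br E (X \<diamondop> Y) - br E X \<diamondop> Y - X \<diamondop> br E Y = X \<diamondop> Y"
    and XY: "X \<in> V" "Y \<in> V"
  shows "nab X (nab Y E) - nab (nab X Y) E = 0"
proof -
  have aff: "br E (D X Y) = D (br E X) Y + D X (br E Y)" if "X \<in> V" "Y \<in> V" for X Y
    using homothetic_imp_affine_field[OF E hom] that by (simp add: affine_field_def)
  have "- br E e = e"
    using scale[of e e] E by simp
  then have br_unit: "br E e = - e"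
    by (metis minus_minus)
  have br_mul: "br E (X \<diamondop> Y) = br E X \<diamondop> Y + X \<diamondop> br E Y + X \<diamondop> Y"
    if "X \<in> V" "Y \<in> V" for X Y
    using scale[OF that] by (simp add: algebra_simps)
  have br_diff: "br E (X - Y) = br E X - br E Y" if "X \<in> V" "Y \<in> V" for X Y
    using that E by (simp add: br_torsion D_diff_left D_diff_right)
  have "nab.affine_field E"
    using E unfolding nab.affine_field_def
    by (simp add: nab_def aff br_unit br_mul br_diff D_add_left D_minus_right)
  then show ?thesis
    using nab.second_deriv_affine_field[of E X Y] E XY nab_flat[of E X Y] by simp
qed

end

section \<open>Functions of class $C^k$\<close>

lemma frechet_derivative_eqI: "(f has_derivative F) (at x) \<Longrightarrow> frechet_derivative f (at x) = F"
  using frechet_derivative_at by metis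

lemma Ck_on_cong:
  assumes "open S" "\<And>x. x \<in> S \<Longrightarrow> f x = h x" "Ck_on k S f"
  shows "Ck_on k S h"
  using assms(2,3)
proof (induction k arbitrary: f h)
  case 0
  then show ?case by (simp cong: continuous_on_cong)
next
  case (Suc k)
  have deriv: "(h has_derivative frechet_derivative f (at x)) (at x)" if "x \<in> S" for x
    by (rule has_derivative_transform_within_open[OF _ \<open>open S\<close> that Suc.prems(1)])
       (use Suc.prems(2) that in \<open>auto simp: frechet_derivative_works\<close>)
  show ?case
    unfolding Ck_on.simps
  proof (intro conjI ballI allI)
    show "h differentiable at x" if "x \<in> S" for x
      using deriv[OF that] by (auto simp: differentiable_def)
    show "Ck_on k S (\<lambda>x. frechet_derivative h (at x) v)" for v
      by (rule Suc.IH[of "\<lambda>x. frechet_derivative f (at x) v"])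
         (use Suc.prems(2) in \<open>simp_all add: frechet_derivative_eqI[OF deriv]\<close>)
  qed
qed

text \<open>Any family \<open>F\<close> of derivatives may replace the chosen one on an open set, which makes the inductive
proofs of closure properties follow the usual differentiation rules.\<close>

lemma Ck_on_SucI:
  assumes "open S" "\<And>x. x \<in> S \<Longrightarrow> (f has_derivative F x) (at x)"
    "\<And>v. Ck_on k S (\<lambda>x. F x v)"
  shows "Ck_on (Suc k) S f"
  unfolding Ck_on.simps
proof (intro conjI ballI allI)
  show "f differentiable at x" if "x \<in> S" for x
    using assms(2)[OF that] by (auto simp: differentiable_def)
  show "Ck_on k S (\<lambda>x. frechet_derivative f (at x) v)" for v
    by (rule Ck_on_cong[OF assms(1) _ assms(3)[of v]])
       (simp add: frechet_derivative_eqI[OF assms(2)])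
qed

lemma Ck_on_has_derivative:
  "Ck_on (Suc k) S f \<Longrightarrow> x \<in> S \<Longrightarrow> (f has_derivative frechet_derivative f (at x)) (at x)"
  by (simp add: frechet_derivative_works)

lemma Ck_on_SucD: "Ck_on (Suc k) S f \<Longrightarrow> Ck_on k S f"
proof (induction k arbitrary: f)
  case 0
  then show ?case
    by (auto intro!: continuous_at_imp_continuous_on differentiable_imp_continuous_within)
next
  case (Suc k)
  then show ?case
    unfolding Ck_on.simps(2)[of "Suc k"] Ck_on.simps(2)[of k _ f] by blast
qed

lemma Ck_on_subset: "Ck_on k S f \<Longrightarrow> T \<subseteq> S \<Longrightarrow> Ck_on k T f"
  by (induction k arbitrary: f) (auto intro: continuous_on_subset)

lemma Ck_on_const: "open S \<Longrightarrow> Ck_on k S (\<lambda>_. c)"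
  by (induction k arbitrary: c) simp_all

lemma Ck_on_add:
  assumes "open S" "Ck_on k S f" "Ck_on k S h"
  shows "Ck_on k S (\<lambda>x. f x + h x)"
  using assms(2,3)
proof (induction k arbitrary: f h)
  case 0
  then show ?case by (simp add: continuous_on_add continuous_on_mult)
next
  case (Suc k)
  show ?case
  proof (rule Ck_on_SucI[OF \<open>open S\<close>])
    show "((\<lambda>x. f x + h x) has_derivative
        (\<lambda>v. frechet_derivative f (at x) v + frechet_derivative h (at x) v)) (at x)"
      if "x \<in> S" for x
      using Suc.prems that by (intro has_derivative_add Ck_on_has_derivative)
    show "Ck_on k S (\<lambda>x. frechet_derivative f (at x) v + frechet_derivative h (at x) v)" for v
      using Suc by simp
  qed
qed

lemma Ck_on_sum:
  assumes "open S" "\<And>i. i \<in> I \<Longrightarrow> Ck_on k S (f i)"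
  shows "Ck_on k S (\<lambda>x. \<Sum>i\<in>I. f i x)"
  using assms(2)
  by (induction I rule: infinite_finite_induct) (simp_all add: Ck_on_const Ck_on_add assms(1))

lemma Ck_on_bounded_linear:
  assumes "open S" "bounded_linear l" "Ck_on k S f"
  shows "Ck_on k S (\<lambda>x. l (f x))"
  using assms(3)
proof (induction k arbitrary: f)
  case 0
  then show ?case
    using bounded_linear.continuous_on[OF assms(2)] by simp
next
  case (Suc k)
  show ?case
  proof (rule Ck_on_SucI[OF \<open>open S\<close>])
    show "((\<lambda>x. l (f x)) has_derivative (\<lambda>v. l (frechet_derivative f (at x) v))) (at x)"
      if "x \<in> S" for x
      using bounded_linear.has_derivative[OF assms(2) Ck_on_has_derivative] Suc.prems that .
    show "Ck_on k S (\<lambda>x. l (frechet_derivative f (at x) v))" for v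
      using Suc by simp
  qed
qed

lemma Ck_on_mult:
  fixes f h :: "'e::real_normed_vector \<Rightarrow> real"
  assumes "open S" "Ck_on k S f" "Ck_on k S h"
  shows "Ck_on k S (\<lambda>x. f x * h x)"
  using assms(2,3)
proof (induction k arbitrary: f h)
  case 0
  then show ?case by (simp add: continuous_on_add continuous_on_mult)
next
  case (Suc k)
  show ?case
  proof (rule Ck_on_SucI[OF \<open>open S\<close>])
    show "((\<lambda>x. f x * h x) has_derivative
        (\<lambda>v. f x * frechet_derivative h (at x) v + frechet_derivative f (at x) v * h x)) (at x)"
      if "x \<in> S" for x
      using Suc.prems that by (intro has_derivative_mult Ck_on_has_derivative)
    show "Ck_on k S (\<lambda>x. f x * frechet_derivative h (at x) v
        + frechet_derivative f (at x) v * h x)" for v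
      using Suc.prems Ck_on_SucD[OF Suc.prems(1)] Ck_on_SucD[OF Suc.prems(2)]
      by (intro Ck_on_add Suc.IH \<open>open S\<close>) simp_all
  qed
qed

text \<open>The chain rule expanded in a basis, so that the partial derivatives of \<open>f\<close> enter with constant
directions: the recursion defining \<open>Ck_on\<close> only speaks of derivatives in a fixed direction.\<close>

lemma has_derivative_compose_basis:
  fixes f :: "'e::euclidean_space \<Rightarrow> real" and h :: "'d::euclidean_space \<Rightarrow> 'e"
  assumes "h differentiable at x" "f differentiable at (h x)"
  shows "(f \<circ> h has_derivative (\<lambda>v. \<Sum>b\<in>Basis. (frechet_derivative h (at x) v \<bullet> b)
      * frechet_derivative f (at (h x)) b)) (at x)"
proof -
  have f: "(f has_derivative frechet_derivative f (at (h x))) (at (h x))"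
    and h: "(h has_derivative frechet_derivative h (at x)) (at x)"
    using assms by (simp_all add: frechet_derivative_works)
  interpret bounded_linear "frechet_derivative f (at (h x))"
    using f by (rule has_derivative_bounded_linear)
  have "frechet_derivative f (at (h x)) w
      = (\<Sum>b\<in>Basis. (w \<bullet> b) * frechet_derivative f (at (h x)) b)" for w
  proof -
    have "frechet_derivative f (at (h x)) w
        = frechet_derivative f (at (h x)) (\<Sum>b\<in>Basis. (w \<bullet> b) *\<^sub>R b)"
      by (simp only: euclidean_representation)
    then show ?thesis
      by (simp only: sum scaleR real_scaleR_def)
  qed
  then have "frechet_derivative f (at (h x)) \<circ> frechet_derivative h (at x)
      = (\<lambda>v. \<Sum>b\<in>Basis. (frechet_derivative h (at x) v \<bullet> b) * frechet_derivative f (at (h x)) b)"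
    unfolding o_def by blast
  then show ?thesis
    using diff_chain_at[OF h f] by simp
qed

lemma Ck_on_compose:
  fixes f :: "'e::euclidean_space \<Rightarrow> real" and h :: "'d::euclidean_space \<Rightarrow> 'e"
  assumes "open S" "h ` S \<subseteq> T" "Ck_on k S h" "Ck_on k T f"
  shows "Ck_on k S (f \<circ> h)"
  using assms(3,4)
proof (induction k arbitrary: f)
  case 0
  then show ?case using assms(2) by (auto intro!: continuous_on_compose simp del: o_apply intro: continuous_on_subset)
next
  case (Suc k)
  show ?case
  proof (rule Ck_on_SucI[OF \<open>open S\<close>])
    show "(f \<circ> h has_derivative (\<lambda>v. \<Sum>b\<in>Basis. (frechet_derivative h (at x) v \<bullet> b)
        * frechet_derivative f (at (h x)) b)) (at x)" if "x \<in> S" for x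
      using Suc.prems that assms(2) by (intro has_derivative_compose_basis) auto
    have "Ck_on k S ((\<lambda>y. frechet_derivative f (at y) b) \<circ> h)" for b
      using Suc.prems Ck_on_SucD[OF Suc.prems(1)] by (intro Suc.IH) simp_all
    moreover have "Ck_on k S (\<lambda>x. frechet_derivative h (at x) v \<bullet> b)" for v b
      using Suc.prems(1) by (intro Ck_on_bounded_linear[OF \<open>open S\<close> bounded_linear_inner_left]) simp
    ultimately show "Ck_on k S (\<lambda>x. \<Sum>b\<in>Basis. (frechet_derivative h (at x) v \<bullet> b)
        * frechet_derivative f (at (h x)) b)" for v
      by (intro Ck_on_sum Ck_on_mult \<open>open S\<close>) (auto simp: o_def)
  qed
qed

section \<open>Vector fields on a smooth manifold\<close>

locale manifold =
  fixes M :: "('a, 'e::euclidean_space) mfd"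
  assumes manifold: "smooth_manifold M"
begin

lemma chart_open: "(W, \<phi>) \<in> charts M \<Longrightarrow> openin (mtop M) W"
  using manifold unfolding smooth_manifold_def by blast

lemma chart_homeomorphic:
  "(W, \<phi>) \<in> charts M \<Longrightarrow>
    homeomorphic_map (subtopology (mtop M) W) (top_of_set (\<phi> ` W)) \<phi>"
  using manifold unfolding smooth_manifold_def by blast

lemma chart_cover: "p \<in> carr M \<Longrightarrow> \<exists>W \<phi>. (W, \<phi>) \<in> charts M \<and> p \<in> W"
  using manifold unfolding smooth_manifold_def by blast

lemma chart_inj: "(W, \<phi>) \<in> charts M \<Longrightarrow> inj_on \<phi> W"
  using homeomorphic_imp_injective_map[OF chart_homeomorphic] openin_subset[OF chart_open]
  by (metis inf.absorb_iff2 topspace_subtopology)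

lemma chart_image_open:
  assumes c: "(W, \<phi>) \<in> charts M" and U: "openin (mtop M) U"
  shows "open (\<phi> ` (U \<inter> W))"
proof -
  have "openin (subtopology (mtop M) W) (U \<inter> W)"
    using U by (auto simp: openin_subtopology)
  then have "openin (top_of_set (\<phi> ` W)) (\<phi> ` (U \<inter> W))"
    using homeomorphic_imp_open_map[OF chart_homeomorphic[OF c]] by (auto simp: open_map_def)
  moreover have "open (\<phi> ` W)"
    using manifold c unfolding smooth_manifold_def by blast
  ultimately show ?thesis
    by (metis openin_open_eq)
qed

lemma transition_smooth:
  "(W, \<phi>) \<in> charts M \<Longrightarrow> (W', \<psi>) \<in> charts M \<Longrightarrow>
    smooth_on (\<phi> ` (W \<inter> W')) (\<psi> \<circ> inv_into W \<phi>)"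
  using manifold unfolding smooth_manifold_def by blast

lemma inv_chart: "(W, \<phi>) \<in> charts M \<Longrightarrow> p \<in> W \<Longrightarrow> inv_into W \<phi> (\<phi> p) = p"
  by (simp add: chart_inj)


subsection \<open>Smooth functions\<close>

lemma smooth_fun_openin: "smooth_fun M U f \<Longrightarrow> openin (mtop M) U"
  by (simp add: smooth_fun_def)

lemma smooth_funI:
  assumes "openin (mtop M) U"
    and "\<And>W \<phi> k. (W, \<phi>) \<in> charts M \<Longrightarrow> Ck_on k (\<phi> ` (U \<inter> W)) (f \<circ> inv_into W \<phi>)"
  shows "smooth_fun M U f"
  using assms by (auto simp: smooth_fun_def smooth_on_def)

lemma smooth_funD:
  "smooth_fun M U f \<Longrightarrow> (W, \<phi>) \<in> charts M \<Longrightarrow> Ck_on k (\<phi> ` (U \<inter> W)) (f \<circ> inv_into W \<phi>)"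
  by (auto simp: smooth_fun_def smooth_on_def)

lemma smooth_fun_cong:
  assumes f: "smooth_fun M U f" and eq: "\<And>p. p \<in> U \<Longrightarrow> f p = h p"
  shows "smooth_fun M U h"
proof (rule smooth_funI[OF smooth_fun_openin[OF f]])
  fix W \<phi> k assume c: "(W, \<phi>) \<in> charts M"
  show "Ck_on k (\<phi> ` (U \<inter> W)) (h \<circ> inv_into W \<phi>)"
    by (rule Ck_on_cong[OF chart_image_open[OF c smooth_fun_openin[OF f]] _ smooth_funD[OF f c]])
       (auto simp: inv_chart[OF c] eq)
qed

lemma smooth_fun_subset: "smooth_fun M U f \<Longrightarrow> openin (mtop M) V \<Longrightarrow> V \<subseteq> U \<Longrightarrow> smooth_fun M V f"
  by (rule smooth_funI) (auto intro!: Ck_on_subset[OF smooth_funD])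

lemma smooth_fun_add:
  assumes f: "smooth_fun M U f" and h: "smooth_fun M U h"
  shows "smooth_fun M U (\<lambda>p. f p + h p)"
proof (rule smooth_funI[OF smooth_fun_openin[OF f]])
  fix W \<phi> k assume c: "(W, \<phi>) \<in> charts M"
  show "Ck_on k (\<phi> ` (U \<inter> W)) ((\<lambda>p. f p + h p) \<circ> inv_into W \<phi>)"
    using Ck_on_add[OF chart_image_open[OF c smooth_fun_openin[OF f]] smooth_funD[OF f c]
        smooth_funD[OF h c]] by (simp add: o_def)
qed

lemma smooth_fun_mult:
  assumes f: "smooth_fun M U f" and h: "smooth_fun M U h"
  shows "smooth_fun M U (\<lambda>p. f p * h p)"
proof (rule smooth_funI[OF smooth_fun_openin[OF f]])
  fix W \<phi> k assume c: "(W, \<phi>) \<in> charts M"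
  show "Ck_on k (\<phi> ` (U \<inter> W)) ((\<lambda>p. f p * h p) \<circ> inv_into W \<phi>)"
    using Ck_on_mult[OF chart_image_open[OF c smooth_fun_openin[OF f]] smooth_funD[OF f c]
        smooth_funD[OF h c]] by (simp add: o_def)
qed

lemma smooth_fun_const: "openin (mtop M) U \<Longrightarrow> smooth_fun M U (\<lambda>_. c)"
  by (intro smooth_funI) (auto simp: o_def intro!: Ck_on_const chart_image_open)

lemma smooth_fun_scale: "smooth_fun M U f \<Longrightarrow> smooth_fun M U (\<lambda>p. c * f p)"
  by (intro smooth_fun_mult smooth_fun_const smooth_fun_openin)

lemma smooth_fun_diff: "smooth_fun M U f \<Longrightarrow> smooth_fun M U h \<Longrightarrow> smooth_fun M U (\<lambda>p. f p - h p)"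
  using smooth_fun_add[of U f "\<lambda>p. - 1 * h p"] smooth_fun_scale[of U h "- 1"] by simp

lemma smooth_nearI: "smooth_fun M U f \<Longrightarrow> p \<in> U \<Longrightarrow> smooth_near M p f"
  by (auto simp: smooth_near_def)

lemma smooth_near_cong:
  assumes V: "openin (mtop M) V" "p \<in> V" and eq: "\<And>q. q \<in> V \<Longrightarrow> f q = h q"
  shows "smooth_near M p f \<longleftrightarrow> smooth_near M p h"
proof -
  have "smooth_near M p h" if near: "smooth_near M p f" and eq: "\<And>q. q \<in> V \<Longrightarrow> f q = h q" for f h
  proof -
    obtain U where U: "p \<in> U" "smooth_fun M U f"
      using near by (auto simp: smooth_near_def)
    have "smooth_fun M (U \<inter> V) f"
      using U V by (auto intro!: smooth_fun_subset[OF U(2)] openin_Int smooth_fun_openin[OF U(2)])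
    then have "smooth_fun M (U \<inter> V) h"
      by (rule smooth_fun_cong) (simp add: eq)
    then show ?thesis
      using U V by (auto intro: smooth_nearI)
  qed
  then show ?thesis
    using eq by metis
qed

lemma smooth_near_differentiable:
  assumes "smooth_near M p f" "(W, \<phi>) \<in> charts M" "p \<in> W"
  shows "f \<circ> inv_into W \<phi> differentiable at (\<phi> p)"
proof -
  obtain U where "p \<in> U" "smooth_fun M U f"
    using assms(1) by (auto simp: smooth_near_def)
  then show ?thesis
    using smooth_funD[of U f W \<phi> "Suc 0"] assms by auto
qed


subsection \<open>Tangent vectors\<close>

text \<open>The chain rule for the transition map.  It makes the tangent space at \<open>p\<close>, a union over all charts,
the set of directional derivatives of a single chart.\<close>

lemma coord_vector_change:
  assumes c: "(W, \<phi>) \<in> charts M" and c': "(W', \<psi>) \<in> charts M" and p: "p \<in> W" "p \<in> W'"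
  shows "coord_vector M W \<phi> p v
    = coord_vector M W' \<psi> p (frechet_derivative (\<psi> \<circ> inv_into W \<phi>) (at (\<phi> p)) v)"
proof
  fix f
  have "frechet_derivative (f \<circ> inv_into W \<phi>) (at (\<phi> p)) v
      = frechet_derivative (f \<circ> inv_into W' \<psi>) (at (\<psi> p))
          (frechet_derivative (\<psi> \<circ> inv_into W \<phi>) (at (\<phi> p)) v)"
    if near: "smooth_near M p f"
  proof -
    let ?t = "\<psi> \<circ> inv_into W \<phi>"
    have "Ck_on (Suc 0) (\<phi> ` (W \<inter> W')) ?t"
      using transition_smooth[OF c c'] by (simp only: smooth_on_def)
    then have t: "(?t has_derivative frechet_derivative ?t (at (\<phi> p))) (at (\<phi> p))"
      by (rule Ck_on_has_derivative) (use p in auto)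
    have tp: "?t (\<phi> p) = \<psi> p"
      using p by (simp add: inv_chart[OF c])
    have f: "(f \<circ> inv_into W' \<psi> has_derivative
        frechet_derivative (f \<circ> inv_into W' \<psi>) (at (\<psi> p))) (at (?t (\<phi> p)))"
      using smooth_near_differentiable[OF near c' p(2)]
      by (simp only: tp frechet_derivative_works)
    have "(f \<circ> inv_into W \<phi> has_derivative frechet_derivative (f \<circ> inv_into W' \<psi>) (at (\<psi> p))
        \<circ> frechet_derivative ?t (at (\<phi> p))) (at (\<phi> p))"
    proof (rule has_derivative_transform_within_open[OF diff_chain_at[OF t f]])
      show "open (\<phi> ` (W' \<inter> W))"
        by (rule chart_image_open[OF c chart_open[OF c']])
    qed (use p in \<open>auto simp: inv_chart[OF c] inv_chart[OF c']\<close>)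
    then show ?thesis
      by (simp add: frechet_derivative_eqI)
  qed
  then show "coord_vector M W \<phi> p v f
    = coord_vector M W' \<psi> p (frechet_derivative (\<psi> \<circ> inv_into W \<phi>) (at (\<phi> p)) v) f"
    by (simp add: coord_vector_def)
qed

lemma tangent_space_chart:
  assumes c: "(W, \<phi>) \<in> charts M" and p: "p \<in> W"
  shows "tangent_space M p = range (coord_vector M W \<phi> p)"
proof
  show "tangent_space M p \<subseteq> range (coord_vector M W \<phi> p)"
  proof
    fix u assume "u \<in> tangent_space M p"
    then obtain W' \<psi> v where "u = coord_vector M W' \<psi> p v" "(W', \<psi>) \<in> charts M" "p \<in> W'"
      by (auto simp: tangent_space_def)
    then show "u \<in> range (coord_vector M W \<phi> p)"
      using coord_vector_change[OF _ c _ p, of W' \<psi> v] by simp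
  qed
qed (use c p in \<open>auto simp: tangent_space_def\<close>)

lemma tangent_space_carr:
  assumes "u \<in> tangent_space M p"
  shows "p \<in> carr M"
proof -
  obtain W \<phi> where "(W, \<phi>) \<in> charts M" "p \<in> W"
    using assms by (auto simp: tangent_space_def)
  then show ?thesis
    using openin_subset[OF chart_open] by blast
qed

lemma coord_vector_bounded_linear:
  assumes "(W, \<phi>) \<in> charts M" "p \<in> W" "smooth_near M p f"
  shows "bounded_linear (\<lambda>v. coord_vector M W \<phi> p v f)"
  using smooth_near_differentiable[OF assms(3,1,2)] assms(3)
  by (simp add: coord_vector_def frechet_derivative_works has_derivative_bounded_linear)

lemma tangent_diff:
  assumes "u \<in> tangent_space M p" "v \<in> tangent_space M p"
  shows "u - v \<in> tangent_space M p"
proof -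
  obtain W \<phi> where c: "(W, \<phi>) \<in> charts M" and p: "p \<in> W"
    using chart_cover[OF tangent_space_carr[OF assms(1)]] by blast
  obtain a b where ab: "u = coord_vector M W \<phi> p a" "v = coord_vector M W \<phi> p b"
    using assms by (auto simp: tangent_space_chart[OF c p])
  have "u - v = coord_vector M W \<phi> p (a - b)"
  proof
    fix f
    show "(u - v) f = coord_vector M W \<phi> p (a - b) f"
    proof (cases "smooth_near M p f")
      case True
      then show ?thesis
        using linear_diff[OF bounded_linear.linear[OF coord_vector_bounded_linear[OF c p True]], of a b]
        by (simp add: ab)
    qed (simp add: ab coord_vector_def)
  qed
  then show ?thesis
    by (simp add: tangent_space_chart[OF c p])
qed

lemma tangent_scale:
  assumes "u \<in> tangent_space M p"
  shows "tscale r u \<in> tangent_space M p"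
proof -
  obtain W \<phi> where c: "(W, \<phi>) \<in> charts M" and p: "p \<in> W"
    using chart_cover[OF tangent_space_carr[OF assms]] by blast
  obtain a where a: "u = coord_vector M W \<phi> p a"
    using assms by (auto simp: tangent_space_chart[OF c p])
  have "tscale r u = coord_vector M W \<phi> p (r *\<^sub>R a)"
  proof
    fix f
    show "tscale r u f = coord_vector M W \<phi> p (r *\<^sub>R a) f"
    proof (cases "smooth_near M p f")
      case True
      then show ?thesis
        using linear_scale[OF bounded_linear.linear[OF coord_vector_bounded_linear[OF c p True]], of r a]
        by (simp add: a tscale_def)
    qed (simp add: a coord_vector_def tscale_def)
  qed
  then show ?thesis
    by (simp add: tangent_space_chart[OF c p])
qed

lemma tangent_add:
  assumes "u \<in> tangent_space M p" "v \<in> tangent_space M p"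
  shows "u + v \<in> tangent_space M p"
proof -
  have "u - tscale (- 1) v \<in> tangent_space M p"
    using assms by (intro tangent_diff tangent_scale)
  moreover have "u - tscale (- 1) v = u + v"
    by (rule ext) (simp add: tscale_def)
  ultimately show ?thesis
    by simp
qed

lemma tangent_apply_not_smooth:
  "u \<in> tangent_space M p \<Longrightarrow> \<not> smooth_near M p f \<Longrightarrow> u f = 0"
  by (auto simp: tangent_space_def coord_vector_def)

lemma tangent_apply_local:
  assumes u: "u \<in> tangent_space M p" and V: "openin (mtop M) V" "p \<in> V"
    and eq: "\<And>q. q \<in> V \<Longrightarrow> f q = h q"
  shows "u f = u h"
proof (cases "smooth_near M p f")
  case True
  obtain W \<phi> v where c: "(W, \<phi>) \<in> charts M" "p \<in> W" and uv: "u = coord_vector M W \<phi> p v"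
    using u by (auto simp: tangent_space_def)
  have "(h \<circ> inv_into W \<phi> has_derivative frechet_derivative (f \<circ> inv_into W \<phi>) (at (\<phi> p))) (at (\<phi> p))"
  proof (rule has_derivative_transform_within_open)
    show "(f \<circ> inv_into W \<phi> has_derivative frechet_derivative (f \<circ> inv_into W \<phi>) (at (\<phi> p))) (at (\<phi> p))"
      using smooth_near_differentiable[OF True c] by (simp add: frechet_derivative_works)
    show "open (\<phi> ` (V \<inter> W))"
      by (rule chart_image_open[OF c(1) V(1)])
  qed (use c V eq in \<open>auto simp: inv_chart[OF c(1)]\<close>)
  then show ?thesis
    using smooth_near_cong[OF V eq] by (simp add: uv coord_vector_def frechet_derivative_eqI)
next
  case False
  then show ?thesis
    using smooth_near_cong[OF V eq] tangent_apply_not_smooth[OF u] by simp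
qed

lemma tangent_apply_linear:
  assumes u: "u \<in> tangent_space M p" and f: "smooth_fun M U f" and h: "smooth_fun M U h" and p: "p \<in> U"
  shows "u (\<lambda>q. f q + h q) = u f + u h" "u (\<lambda>q. f q - h q) = u f - u h"
    "u (\<lambda>q. r * f q) = r * u f"
proof -
  obtain W \<phi> v where c: "(W, \<phi>) \<in> charts M" "p \<in> W" and uv: "u = coord_vector M W \<phi> p v"
    using u by (auto simp: tangent_space_def)
  have df: "(f \<circ> inv_into W \<phi> has_derivative frechet_derivative (f \<circ> inv_into W \<phi>) (at (\<phi> p))) (at (\<phi> p))"
    if "smooth_fun M U f" for f
    using smooth_near_differentiable[OF smooth_nearI[OF that p] c]
    by (simp add: frechet_derivative_works)
  note near = smooth_nearI[OF _ p]
  show "u (\<lambda>q. f q + h q) = u f + u h"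
    using frechet_derivative_eqI[OF has_derivative_add[OF df[OF f] df[OF h]]]
      near[OF smooth_fun_add[OF f h]] near[OF f] near[OF h]
    by (simp add: uv coord_vector_def o_def)
  show "u (\<lambda>q. f q - h q) = u f - u h"
    using frechet_derivative_eqI[OF has_derivative_diff[OF df[OF f] df[OF h]]]
      near[OF smooth_fun_diff[OF f h]] near[OF f] near[OF h]
    by (simp add: uv coord_vector_def o_def)
  show "u (\<lambda>q. r * f q) = r * u f"
    using frechet_derivative_eqI[OF has_derivative_mult_right[OF df[OF f], of r]]
      near[OF smooth_fun_scale[OF f]] near[OF f]
    by (simp add: uv coord_vector_def o_def)
qed


subsection \<open>Smooth vector fields\<close>

lemma smooth_vf_openin: "smooth_vf M U X \<Longrightarrow> openin (mtop M) U"
  by (simp add: smooth_vf_def)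

lemma smooth_vf_tangent: "smooth_vf M U X \<Longrightarrow> p \<in> U \<Longrightarrow> X p \<in> tangent_space M p"
  by (simp add: smooth_vf_def)

lemma smooth_vf_apply:
  "smooth_vf M U X \<Longrightarrow> V \<subseteq> U \<Longrightarrow> smooth_fun M V f \<Longrightarrow> smooth_fun M V (\<lambda>p. X p f)"
  by (simp add: smooth_vf_def)

lemma smooth_vf_cong:
  assumes X: "smooth_vf M U X" and eq: "\<And>p. p \<in> U \<Longrightarrow> X p = Y p"
  shows "smooth_vf M U Y"
  unfolding smooth_vf_def
proof (intro conjI allI impI ballI)
  show "smooth_fun M V (\<lambda>p. Y p f)" if V: "V \<subseteq> U \<and> smooth_fun M V f" for V f
    by (rule smooth_fun_cong[OF smooth_vf_apply[OF X, of V f]]) (use V eq in auto)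
qed (use smooth_vf_openin[OF X] smooth_vf_tangent[OF X] eq in auto)

lemma smooth_vf_subset: "smooth_vf M U X \<Longrightarrow> openin (mtop M) V \<Longrightarrow> V \<subseteq> U \<Longrightarrow> smooth_vf M V X"
  by (auto simp: smooth_vf_def)

lemma smooth_vf_add: "smooth_vf M U X \<Longrightarrow> smooth_vf M U Y \<Longrightarrow> smooth_vf M U (X + Y)"
  by (auto simp: smooth_vf_def intro: tangent_add smooth_fun_add)

lemma smooth_vf_diff: "smooth_vf M U X \<Longrightarrow> smooth_vf M U Y \<Longrightarrow> smooth_vf M U (X - Y)"
  by (auto simp: smooth_vf_def intro: tangent_diff smooth_fun_diff)

lemma smooth_vf_vscale: "smooth_fun M U a \<Longrightarrow> smooth_vf M U X \<Longrightarrow> smooth_vf M U (vscale a X)"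
  unfolding smooth_vf_def vscale_def
  by (auto simp: tscale_def intro!: tangent_scale[unfolded tscale_def] smooth_fun_mult
      intro: smooth_fun_subset smooth_fun_openin)

text \<open>In another chart the derivative of a function along the coordinate field is a partial derivative composed with
the transition map.\<close>

lemma smooth_coord_field:
  assumes c: "(W, \<phi>) \<in> charts M"
  shows "smooth_vf M W (\<lambda>q. coord_vector M W \<phi> q v)"
  unfolding smooth_vf_def
proof (intro conjI allI impI ballI)
  fix V f assume "V \<subseteq> W \<and> smooth_fun M V f"
  then have V: "V \<subseteq> W" and f: "smooth_fun M V f"
    by auto
  note V_open = smooth_fun_openin[OF f]
  show "smooth_fun M V (\<lambda>q. coord_vector M W \<phi> q v f)"
  proof (rule smooth_funI[OF V_open])
    fix W' \<psi> k assume c': "(W', \<psi>) \<in> charts M"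
    let ?h = "\<lambda>y. frechet_derivative (f \<circ> inv_into W \<phi>) (at y) v"
    have "Ck_on k (\<phi> ` (V \<inter> W)) ?h"
      using smooth_funD[OF f c, of "Suc k"] by simp
    moreover have "Ck_on k (\<psi> ` (V \<inter> W')) (\<phi> \<circ> inv_into W' \<psi>)"
      using transition_smooth[OF c' c] V by (auto simp: smooth_on_def intro: Ck_on_subset)
    moreover have "(\<phi> \<circ> inv_into W' \<psi>) ` \<psi> ` (V \<inter> W') \<subseteq> \<phi> ` (V \<inter> W)"
      using V by (auto simp: inv_chart[OF c'])
    ultimately have "Ck_on k (\<psi> ` (V \<inter> W')) (?h \<circ> (\<phi> \<circ> inv_into W' \<psi>))"
      by (intro Ck_on_compose[OF chart_image_open[OF c' V_open]])
    then show "Ck_on k (\<psi> ` (V \<inter> W')) ((\<lambda>q. coord_vector M W \<phi> q v f) \<circ> inv_into W' \<psi>)"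
    proof (rule Ck_on_cong[OF chart_image_open[OF c' V_open], rotated])
      fix y assume "y \<in> \<psi> ` (V \<inter> W')"
      then show "(?h \<circ> (\<phi> \<circ> inv_into W' \<psi>)) y = ((\<lambda>q. coord_vector M W \<phi> q v f) \<circ> inv_into W' \<psi>) y"
        using smooth_nearI[OF f] by (auto simp: coord_vector_def inv_chart[OF c'])
    qed
  qed
qed (use c chart_open in \<open>auto simp: tangent_space_def\<close>)

lemma tangent_extend:
  assumes "u \<in> tangent_space M p" "(W, \<phi>) \<in> charts M" "p \<in> W"
  shows "\<exists>Y. smooth_vf M W Y \<and> Y p = u"
  using assms smooth_coord_field[OF assms(2)] by (auto simp: tangent_space_chart)

lemma lie_bracket_cong:
  assumes X: "smooth_vf M U X" and Y: "smooth_vf M U Y"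
    and eq: "\<And>q. q \<in> U \<Longrightarrow> X q = X' q" "\<And>q. q \<in> U \<Longrightarrow> Y q = Y' q" and p: "p \<in> U"
  shows "lie_bracket M X Y p = lie_bracket M X' Y' p"
proof
  fix f
  have "X p (\<lambda>q. Y q f) = X' p (\<lambda>q. Y' q f)"
    using tangent_apply_local[OF smooth_vf_tangent[OF X p] smooth_vf_openin[OF X] p,
        of "\<lambda>q. Y q f" "\<lambda>q. Y' q f"] eq p by simp
  moreover have "Y p (\<lambda>q. X q f) = Y' p (\<lambda>q. X' q f)"
    using tangent_apply_local[OF smooth_vf_tangent[OF Y p] smooth_vf_openin[OF X] p,
        of "\<lambda>q. X q f" "\<lambda>q. X' q f"] eq p by simp
  ultimately show "lie_bracket M X Y p f = lie_bracket M X' Y' p f"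
    by (simp add: lie_bracket_def)
qed

text \<open>For a function smooth near \<open>p\<close> both sides expand into iterated derivatives, which agree after cancellation.  The inner
brackets are given by the defining difference only near \<open>p\<close>, so locality of tangent vectors is needed to expand
them; on other functions all brackets are zero by convention.\<close>

lemma lie_bracket_jacobi:
  assumes X: "smooth_vf M U X" and Y: "smooth_vf M U Y" and Z: "smooth_vf M U Z" and p: "p \<in> U"
  shows "lie_bracket M X (lie_bracket M Y Z) p
    = lie_bracket M (lie_bracket M X Y) Z p + lie_bracket M Y (lie_bracket M X Z) p"
proof
  fix f
  show "lie_bracket M X (lie_bracket M Y Z) p f
    = (lie_bracket M (lie_bracket M X Y) Z p + lie_bracket M Y (lie_bracket M X Z) p) f"
  proof (cases "smooth_near M p f")
    case True
    then obtain N' where N': "p \<in> N'" "smooth_fun M N' f"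
      by (auto simp: smooth_near_def)
    define N where "N = N' \<inter> U"
    have pN: "p \<in> N" and NU: "N \<subseteq> U" and f: "smooth_fun M N f"
      using N' p smooth_fun_openin[OF N'(2)] smooth_vf_openin[OF X]
      by (auto simp: N_def intro: smooth_fun_subset)
    note N = smooth_fun_openin[OF f]
    have outer: "A p (\<lambda>q. lie_bracket M B C q f)
        = A p (\<lambda>q. B q (\<lambda>r. C r f)) - A p (\<lambda>q. C q (\<lambda>r. B r f))"
      if A: "smooth_vf M U A" and B: "smooth_vf M U B" and C: "smooth_vf M U C" for A B C
    proof -
      have "A p (\<lambda>q. lie_bracket M B C q f) = A p (\<lambda>q. B q (\<lambda>r. C r f) - C q (\<lambda>r. B r f))"
        by (rule tangent_apply_local[OF smooth_vf_tangent[OF A p] N pN])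
           (simp add: lie_bracket_def smooth_nearI[OF f])
      also have "\<dots> = A p (\<lambda>q. B q (\<lambda>r. C r f)) - A p (\<lambda>q. C q (\<lambda>r. B r f))"
        by (rule tangent_apply_linear(2)[OF smooth_vf_tangent[OF A p] _ _ pN])
           (intro smooth_vf_apply[OF B NU] smooth_vf_apply[OF C NU] f)+
      finally show ?thesis .
    qed
    have inner: "lie_bracket M B C p (\<lambda>q. A q f)
        = B p (\<lambda>q. C q (\<lambda>r. A r f)) - C p (\<lambda>q. B q (\<lambda>r. A r f))"
      if A: "smooth_vf M U A" for A B C
      using smooth_nearI[OF smooth_vf_apply[OF A NU f] pN] by (simp add: lie_bracket_def)
    show ?thesis
      using True by (simp add: lie_bracket_def[of M X "lie_bracket M Y Z"]
          lie_bracket_def[of M "lie_bracket M X Y" Z] lie_bracket_def[of M Y "lie_bracket M X Z"]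
          outer inner X Y Z)
  qed (simp add: lie_bracket_def)
qed

end

section \<open>F-manifolds with Killing unit\<close>

text \<open>Extension by zero.  Pointwise equations on \<open>V\<close> become equations between functions, which the
abstract theory requires.\<close>

definition restr :: "'a set \<Rightarrow> ('a \<Rightarrow> 'b::zero) \<Rightarrow> 'a \<Rightarrow> 'b" where
  "restr V X = (\<lambda>p. if p \<in> V then X p else 0)"

lemma restr_apply [simp]: "p \<in> V \<Longrightarrow> restr V X p = X p"
  by (simp add: restr_def)

lemma restr_eq_iff: "restr V X = restr V Y \<longleftrightarrow> (\<forall>p\<in>V. X p = Y p)"
  by (auto simp: restr_def fun_eq_iff)

lemma restr_eq_0_iff: "restr V X = 0 \<longleftrightarrow> (\<forall>p\<in>V. X p = 0)"
  by (auto simp: restr_def fun_eq_iff)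

lemma restr_add: "restr V (X + Y) = restr V X + restr V (Y :: 'a \<Rightarrow> 'b::monoid_add)"
  by (auto simp: restr_def)

lemma restr_diff: "restr V (X - Y) = restr V X - restr V (Y :: 'a \<Rightarrow> 'b::group_add)"
  by (auto simp: restr_def)

locale Killing_F_manifold =
  fixes M :: "('a, 'e::euclidean_space) mfd"
    and m :: "'a tproduct" and g :: "'a tmetric" and e :: "'a vfield" and LC :: "'a conn"
  assumes Killing_F: "riemannian_F_manifold_Killing_unit M m g e"
    and levi_civita: "levi_civita M g LC"
begin

sublocale manifold M
  using Killing_F by unfold_locales (simp add: riemannian_F_manifold_Killing_unit_def F_manifold_def)

lemma product: "comm_assoc_product M m"
  and unit: "unit_field M m e"
  and metric: "pseudo_metric M g"
  and LC_connection: "connection M LC"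
  and LC_torsionless: "torsionless M LC"
  and LC_metric: "metric_connection M g LC"
  using Killing_F levi_civita
  by (simp_all add: riemannian_F_manifold_Killing_unit_def F_manifold_def levi_civita_def)

lemma
  assumes u: "u \<in> tangent_space M p" and v: "v \<in> tangent_space M p"
  shows product_commute: "m p u v = m p v u"
    and product_add: "w \<in> tangent_space M p \<Longrightarrow> m p (u + w) v = m p u v + m p w v"
    and product_assoc: "w \<in> tangent_space M p \<Longrightarrow> m p (m p u v) w = m p u (m p v w)"
    and product_scale: "m p (tscale c u) v = tscale c (m p u v)"
proof -
  note rules = product[unfolded comm_assoc_product_def, THEN conjunct1, THEN bspec,
      OF tangent_space_carr[OF u], THEN bspec, OF u, THEN bspec, OF v]
  show "m p u v = m p v u"
    "m p (tscale c u) v = tscale c (m p u v)"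
    "w \<in> tangent_space M p \<Longrightarrow> m p (u + w) v = m p u v + m p w v"
    "w \<in> tangent_space M p \<Longrightarrow> m p (m p u v) w = m p u (m p v w)"
    using rules by blast+
qed

lemma
  assumes u: "u \<in> tangent_space M p" and v: "v \<in> tangent_space M p"
  shows metric_commute: "g p u v = g p v u"
    and metric_add: "w \<in> tangent_space M p \<Longrightarrow> g p (u + w) v = g p u v + g p w v"
    and metric_scale: "g p (tscale c u) v = c * g p u v"
proof -
  note rules = metric[unfolded pseudo_metric_def, THEN conjunct1, THEN bspec,
      OF tangent_space_carr[OF u], THEN bspec, OF u, THEN conjunct1, THEN bspec, OF v]
  show "g p u v = g p v u" "g p (tscale c u) v = c * g p u v"
    "w \<in> tangent_space M p \<Longrightarrow> g p (u + w) v = g p u v + g p w v"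
    using rules by blast+
qed

lemma metric_nondegenerate:
  assumes u: "u \<in> tangent_space M p" and zero: "\<And>v. v \<in> tangent_space M p \<Longrightarrow> g p u v = 0"
  shows "u = 0"
  using metric[unfolded pseudo_metric_def, THEN conjunct1, THEN bspec,
      OF tangent_space_carr[OF u], THEN bspec, OF u, THEN conjunct2] zero by simp

lemma smooth_vprod [simp]: "smooth_vf M U X \<Longrightarrow> smooth_vf M U Y \<Longrightarrow> smooth_vf M U (vprod m X Y)"
  by (rule product[unfolded comm_assoc_product_def, THEN conjunct2, rule_format]) simp

lemma smooth_vinner [simp]: "smooth_vf M U X \<Longrightarrow> smooth_vf M U Y \<Longrightarrow> smooth_fun M U (vinner g X Y)"
  by (rule metric[unfolded pseudo_metric_def, THEN conjunct2, rule_format]) simp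

lemma smooth_LC [simp]: "smooth_vf M U X \<Longrightarrow> smooth_vf M U Y \<Longrightarrow> smooth_vf M U (LC X Y)"
  by (rule LC_connection[unfolded connection_def, THEN conjunct1, rule_format]) simp

lemma LC_cong:
  assumes "smooth_vf M U X" "smooth_vf M U Y"
    "\<And>q. q \<in> U \<Longrightarrow> X q = X' q" "\<And>q. q \<in> U \<Longrightarrow> Y q = Y' q" "p \<in> U"
  shows "LC X Y p = LC X' Y' p"
  by (rule LC_connection[unfolded connection_def, THEN conjunct2, THEN conjunct1, rule_format, of U])
    (use assms smooth_vf_cong[OF assms(1,3)] smooth_vf_cong[OF assms(2,4)] in simp_all)

lemma
  assumes X: "smooth_vf M U X" and Y: "smooth_vf M U Y" and p: "p \<in> U"
  shows LC_add_left: "smooth_vf M U Z \<Longrightarrow> LC (X + Z) Y p = LC X Y p + LC Z Y p"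
    and LC_add_right: "smooth_vf M U Z \<Longrightarrow> LC X (Y + Z) p = LC X Y p + LC X Z p"
    and LC_scale_left: "smooth_fun M U a \<Longrightarrow> LC (vscale a X) Y p = tscale (a p) (LC X Y p)"
    and LC_scale_right: "smooth_fun M U a \<Longrightarrow>
      LC X (vscale a Y) p = tscale (X p a) (Y p) + tscale (a p) (LC X Y p)"
proof -
  note rules = LC_connection[unfolded connection_def, THEN conjunct2, THEN conjunct2, rule_format,
      OF _ p]
  have zero: "smooth_fun M U (\<lambda>_. 0)"
    by (rule smooth_fun_const[OF smooth_vf_openin[OF X]])
  show "LC (X + Z) Y p = LC X Y p + LC Z Y p" if "smooth_vf M U Z"
    using rules[of X Z Y "\<lambda>_. 0"] X Y that zero by simp
  show "LC X (Y + Z) p = LC X Y p + LC X Z p" if "smooth_vf M U Z"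
    using rules[of X Y Z "\<lambda>_. 0"] X Y that zero by simp
  show "LC (vscale a X) Y p = tscale (a p) (LC X Y p)"
    "LC X (vscale a Y) p = tscale (X p a) (Y p) + tscale (a p) (LC X Y p)" if "smooth_fun M U a"
    using rules[of X Y X a] X Y that by simp_all
qed

lemma lie_bracket_LC:
  assumes "smooth_vf M U X" "smooth_vf M U Y" "p \<in> U"
  shows "lie_bracket M X Y p = LC X Y p - LC Y X p"
proof -
  have "(LC X Y - LC Y X - lie_bracket M X Y) p = 0"
    by (rule LC_torsionless[unfolded torsionless_def, rule_format, of U]) (simp_all add: assms)
  then show ?thesis
    by simp
qed

text \<open>That the bracket of two fields takes values in the tangent spaces is inherited from the torsionless
connection.\<close>

lemma smooth_lie_bracket [simp]:
  assumes "smooth_vf M U X" "smooth_vf M U Y"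
  shows "smooth_vf M U (lie_bracket M X Y)"
  by (rule smooth_vf_cong[OF smooth_vf_diff[OF smooth_LC[OF assms] smooth_LC[OF assms(2,1)]]])
     (simp add: lie_bracket_LC[OF assms])

lemma metric_LC:
  "smooth_vf M U X \<Longrightarrow> smooth_vf M U Y \<Longrightarrow> smooth_vf M U Z \<Longrightarrow> p \<in> U \<Longrightarrow>
    X p (vinner g Y Z) = vinner g (LC X Y) Z p + vinner g Y (LC X Z) p"
  by (rule LC_metric[unfolded metric_connection_def, rule_format, of U]) simp_all

lemma smooth_unit: "openin (mtop M) U \<Longrightarrow> smooth_vf M U e"
  by (rule smooth_vf_subset[OF unit[unfolded unit_field_def, THEN conjunct1]]) (simp_all add: openin_subset)

lemma unit_product: "u \<in> tangent_space M p \<Longrightarrow> m p (e p) u = u"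
  using unit tangent_space_carr[of u p] by (simp add: unit_field_def)


subsection \<open>Localization\<close>

text \<open>The smooth fields on \<open>V\<close>, represented by their extensions by zero.\<close>

definition fields :: "'a set \<Rightarrow> 'a vfield set" where
  "fields V = {X. smooth_vf M V X \<and> restr V X = X}"

lemma smooth_restr [simp]: "smooth_vf M V X \<Longrightarrow> smooth_vf M V (restr V X)"
  by (rule smooth_vf_cong[where X = X]) simp_all

lemma restr_idem [simp]: "restr V (restr V X) = restr V X"
  by (auto simp: restr_def)

lemma restr_fields [simp]: "smooth_vf M V X \<Longrightarrow> restr V X \<in> fields V"
  by (simp add: fields_def)

lemma fieldsD: "X \<in> fields V \<Longrightarrow> smooth_vf M V X" "X \<in> fields V \<Longrightarrow> restr V X = X"
  by (simp_all add: fields_def)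

text \<open>All operations are local, so cutting off an argument does not change the result on \<open>V\<close>.  These rules
move all cut-offs to the outermost position.\<close>

lemma restr_LC_arg:
  "smooth_vf M V X \<Longrightarrow> smooth_vf M V Y \<Longrightarrow> restr V (LC (restr V X) Y) = restr V (LC X Y)"
  "smooth_vf M V X \<Longrightarrow> smooth_vf M V Y \<Longrightarrow> restr V (LC X (restr V Y)) = restr V (LC X Y)"
  by (auto simp: restr_eq_iff intro: LC_cong[symmetric])

lemma restr_lie_bracket_arg:
  "smooth_vf M V X \<Longrightarrow> smooth_vf M V Y \<Longrightarrow>
    restr V (lie_bracket M (restr V X) Y) = restr V (lie_bracket M X Y)"
  "smooth_vf M V X \<Longrightarrow> smooth_vf M V Y \<Longrightarrow>
    restr V (lie_bracket M X (restr V Y)) = restr V (lie_bracket M X Y)"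
  by (auto simp: restr_eq_iff intro: lie_bracket_cong[symmetric])

lemma restr_vprod_arg:
  "restr V (vprod m (restr V X) Y) = restr V (vprod m X Y)"
  "restr V (vprod m X (restr V Y)) = restr V (vprod m X Y)"
  by (simp_all add: restr_eq_iff vprod_def)

lemma restr_vinner_arg:
  "restr V (vinner g (restr V X) Y) = restr V (vinner g X Y)"
  "restr V (vinner g X (restr V Y)) = restr V (vinner g X Y)"
  by (simp_all add: restr_eq_iff vinner_def)

lemma restr_derivative_arg:
  "restr V (\<lambda>p. restr V X p f) = restr V (\<lambda>p. X p f)"
  "smooth_vf M V X \<Longrightarrow> restr V (\<lambda>p. X p (restr V f)) = restr V (\<lambda>p. X p f)"
  using tangent_apply_local[OF smooth_vf_tangent smooth_vf_openin, of V X _ V X "restr V f" f]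
  by (simp_all add: restr_eq_iff)

lemmas restr_args = restr_LC_arg restr_lie_bracket_arg restr_vprod_arg restr_vinner_arg
  restr_derivative_arg

abbreviation "rLC V \<equiv> (\<lambda>X Y. restr V (LC X Y))"
abbreviation "rbr V \<equiv> (\<lambda>X Y. restr V (lie_bracket M X Y))"
abbreviation "rprod V \<equiv> (\<lambda>X Y. restr V (vprod m X Y))"
abbreviation "rinner V \<equiv> (\<lambda>X Y. restr V (vinner g X Y))"
abbreviation "ract V \<equiv> (\<lambda>X f. restr V (\<lambda>p. X p f))"

lemma torsionless_module_fields:
  assumes V: "openin (mtop M) V"
  shows "torsionless_module (fields V) (rbr V) (rLC V)"
proof
  fix X Y assume XY: "X \<in> fields V" "Y \<in> fields V"
  note XY' = fieldsD[OF XY(1)] fieldsD[OF XY(2)]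
  show "rLC V X Y \<in> fields V"
    using XY' by simp
  show "X - Y \<in> fields V"
    using XY' smooth_vf_diff[of V X Y] by (simp add: fields_def restr_diff)
  show "rbr V X Y = rLC V X Y - rLC V Y X"
    using XY' by (simp add: restr_diff[symmetric] restr_eq_iff lie_bracket_LC)
  fix Z assume Z: "Z \<in> fields V"
  note Z' = fieldsD[OF Z]
  show "rLC V (X + Y) Z = rLC V X Z + rLC V Y Z" "rLC V X (Y + Z) = rLC V X Y + rLC V X Z"
    using LC_add_left[OF XY'(1) Z'(1) _ XY'(3)] LC_add_right[OF XY'(1,3) _ Z'(1)]
    by (simp_all add: restr_add[symmetric] restr_eq_iff)
qed

text \<open>The open set must lie in the domain of a chart because nondegeneracy needs enough fields on it: every tangent
vector at a point of \<open>V\<close> extends to a coordinate field.\<close>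

lemma metric_module_fields:
  assumes c: "(W, \<phi>) \<in> charts M" and V: "openin (mtop M) V" "V \<subseteq> W"
  shows "metric_module (fields V) (rbr V) (rLC V) {f. smooth_fun M V f} (ract V) (rinner V)"
proof -
  interpret torsionless_module "fields V" "rbr V" "rLC V"
    by (rule torsionless_module_fields[OF V(1)])
  show ?thesis
  proof
    fix X Y assume XY: "X \<in> fields V" "Y \<in> fields V"
    note X = fieldsD[OF XY(1)] and Y = fieldsD[OF XY(2)]
    show "rinner V X Y \<in> {f. smooth_fun M V f}"
      using smooth_fun_cong[OF smooth_vinner[OF X(1) Y(1)], of "rinner V X Y"] by simp
    show "rinner V X Y = rinner V Y X"
      using metric_commute X Y smooth_vf_tangent by (simp add: restr_eq_iff vinner_def)
    show "ract V (rbr V X Y) f = ract V X (ract V Y f) - ract V Y (ract V X f)"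
      if "f \<in> {f. smooth_fun M V f}" for f
    proof -
      have f: "smooth_fun M V f"
        using that by simp
      have "ract V X (ract V Y f) = restr V (\<lambda>p. X p (\<lambda>p. Y p f))"
        "ract V Y (ract V X f) = restr V (\<lambda>p. Y p (\<lambda>p. X p f))"
        by (simp_all add: restr_args X(1) Y(1))
      then show ?thesis
        using smooth_nearI[OF f]
        by (simp add: restr_diff[symmetric] restr_eq_iff lie_bracket_def)
    qed
    fix Z assume Z': "Z \<in> fields V"
    note Z = fieldsD[OF Z']
    have "rbr V X (rbr V Y Z) = restr V (lie_bracket M X (lie_bracket M Y Z))"
      "rbr V (rbr V X Y) Z = restr V (lie_bracket M (lie_bracket M X Y) Z)"
      "rbr V Y (rbr V X Z) = restr V (lie_bracket M Y (lie_bracket M X Z))"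
      by (simp_all add: restr_args X(1) Y(1) Z(1))
    then show "rbr V X (rbr V Y Z) = rbr V (rbr V X Y) Z + rbr V Y (rbr V X Z)"
      using lie_bracket_jacobi[OF X(1) Y(1) Z(1)]
      by (simp only: restr_add[symmetric] restr_eq_iff plus_fun_apply) simp
    show "rinner V (X + Y) Z = rinner V X Z + rinner V Y Z"
      using metric_add X Y Z smooth_vf_tangent
      by (simp add: restr_add[symmetric] restr_eq_iff vinner_def)
    show "ract V X (rinner V Y Z) = rinner V (rLC V X Y) Z + rinner V Y (rLC V X Z)"
      using metric_LC[OF X(1) Y(1) Z(1)]
      by (simp add: restr_args X(1) Y(1) Z(1) restr_add[symmetric]) (simp add: restr_eq_iff)
  next
    fix f h assume "f \<in> {f. smooth_fun M V f}" "h \<in> {f. smooth_fun M V f}"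
    then have fh: "smooth_fun M V f" "smooth_fun M V h"
      by simp_all
    show "f + h \<in> {f. smooth_fun M V f}"
      using smooth_fun_add[OF fh] by (simp add: plus_fun_def)
    fix X assume "X \<in> fields V"
    note X = fieldsD[OF this]
    show "ract V X (f + h) = ract V X f + ract V X h"
      using tangent_apply_linear(1)[OF smooth_vf_tangent[OF X(1)] fh]
      by (simp add: restr_add[symmetric] restr_eq_iff plus_fun_def[of f h])
  next
    fix f c assume "f \<in> {f. smooth_fun M V f}"
    then have f: "smooth_fun M V f"
      by simp
    show "(\<lambda>p. c * f p) \<in> {f. smooth_fun M V f}"
      using smooth_fun_scale[OF f] by simp
    fix X assume "X \<in> fields V"
    note X = fieldsD[OF this]
    show "ract V X (\<lambda>p. c * f p) = (\<lambda>p. c * ract V X f p)"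
      using tangent_apply_linear(3)[OF smooth_vf_tangent[OF X(1)] f f]
      by (auto simp: restr_def)
  next
    fix X assume X': "X \<in> fields V" and zero: "\<And>Z p. Z \<in> fields V \<Longrightarrow> rinner V X Z p = 0"
    note X = fieldsD[OF X']
    have "X p = 0" if p: "p \<in> V" for p
    proof (rule metric_nondegenerate)
      fix u assume "u \<in> tangent_space M p"
      then obtain Z where Z: "smooth_vf M W Z" "Z p = u"
        using tangent_extend[OF _ c] p V by blast
      then have "smooth_vf M V Z"
        using V smooth_vf_subset by blast
      then show "g p (X p) u = 0"
        using zero[of "restr V Z" p] p Z by (simp add: vinner_def)
    qed (use smooth_vf_tangent[OF X(1)] p in auto)
    then have "restr V X = 0"
      by (auto simp: restr_def)
    then show "X = 0"
      by (simp add: X)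
  qed
qed

lemma product_invariant:
  "smooth_vf M V X \<Longrightarrow> smooth_vf M V Y \<Longrightarrow> smooth_vf M V Z \<Longrightarrow> p \<in> V \<Longrightarrow>
    vinner g (vprod m X Y) Z p = vinner g X (vprod m Y Z) p"
  by (rule Killing_F[unfolded riemannian_F_manifold_Killing_unit_def, THEN conjunct2, THEN conjunct2,
      THEN conjunct1, rule_format, of V]) simp_all

lemma Hertling_Manin_fields:
  "smooth_vf M V X \<Longrightarrow> smooth_vf M V Y \<Longrightarrow> smooth_vf M V Z \<Longrightarrow> smooth_vf M V W \<Longrightarrow> p \<in> V \<Longrightarrow>
    lie_product M (vprod m X Y) m Z W p =
      vprod m X (lie_product M Y m Z W) p + vprod m Y (lie_product M X m Z W) p"
  by (rule Killing_F[unfolded riemannian_F_manifold_Killing_unit_def F_manifold_def, THEN conjunct1,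
      THEN conjunct2, THEN conjunct2, THEN conjunct2, rule_format, of V]) simp_all

lemma riemann_product:
  "smooth_vf M V X \<Longrightarrow> smooth_vf M V Y \<Longrightarrow> smooth_vf M V Z \<Longrightarrow> smooth_vf M V W \<Longrightarrow> p \<in> V \<Longrightarrow>
    (riemann M LC Y Z (vprod m X W) + riemann M LC X Y (vprod m Z W)
      + riemann M LC Z X (vprod m Y W)) p = 0"
  by (rule Killing_F[unfolded riemannian_F_manifold_Killing_unit_def, THEN conjunct2, THEN conjunct2,
      THEN conjunct2, THEN conjunct1, rule_format, OF levi_civita, of V]) simp_all

lemma lie_metric_unit:
  "smooth_vf M V X \<Longrightarrow> smooth_vf M V Y \<Longrightarrow> p \<in> V \<Longrightarrow> lie_metric M e g X Y p = 0"
  by (rule Killing_F[unfolded riemannian_F_manifold_Killing_unit_def, THEN conjunct2, THEN conjunct2,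
      THEN conjunct2, THEN conjunct2, rule_format, of V]) simp_all

lemma homothetic_fields:
  assumes c: "(W, \<phi>) \<in> charts M" and V: "openin (mtop M) V" "V \<subseteq> W"
    and E: "smooth_vf M V E"
    and hom: "\<And>X Y p. smooth_vf M V X \<Longrightarrow> smooth_vf M V Y \<Longrightarrow> p \<in> V \<Longrightarrow>
      lie_metric M E g X Y p = d * vinner g X Y p"
  shows "metric_module.homothetic (fields V) (rbr V) (ract V) (rinner V) d (restr V E)"
proof -
  interpret metric_module "fields V" "rbr V" "rLC V" "{f. smooth_fun M V f}" "ract V" "rinner V"
    by (rule metric_module_fields[OF c V])
  show ?thesis
    unfolding homothetic_def
  proof (intro ballI)
    fix Y Z assume YZ: "Y \<in> fields V" "Z \<in> fields V"
    have "ract V (restr V E) (rinner V Y Z) = restr V (\<lambda>p. E p (vinner g Y Z))"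
      "rinner V (rbr V (restr V E) Y) Z = restr V (vinner g (lie_bracket M E Y) Z)"
      "rinner V Y (rbr V (restr V E) Z) = restr V (vinner g Y (lie_bracket M E Z))"
      using YZ E by (simp_all add: restr_args fieldsD)
    then show "ract V (restr V E) (rinner V Y Z) = (\<lambda>p. d * rinner V Y Z p)
        + (rinner V (rbr V (restr V E) Y) Z + rinner V Y (rbr V (restr V E) Z))"
      using hom[OF fieldsD(1)[OF YZ(1)] fieldsD(1)[OF YZ(2)]]
      by (auto simp: fun_eq_iff restr_def lie_metric_def algebra_simps)
  qed
qed

lemma F_module_fields:
  assumes c: "(W, \<phi>) \<in> charts M" and V: "openin (mtop M) V" "V \<subseteq> W"
  shows "F_module (fields V) (rbr V) (rLC V) {f. smooth_fun M V f} (ract V) (rinner V)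
    (rprod V) (restr V e)"
proof -
  interpret metric_module "fields V" "rbr V" "rLC V" "{f. smooth_fun M V f}" "ract V" "rinner V"
    by (rule metric_module_fields[OF c V])
  show ?thesis
  proof
    show "homothetic 0 (restr V e)"
      by (rule homothetic_fields[OF c V smooth_unit[OF V(1)]]) (simp add: lie_metric_unit)
    show "restr V e \<in> fields V"
      using smooth_unit[OF V(1)] by simp
    fix X Y assume XY: "X \<in> fields V" "Y \<in> fields V"
    note X = fieldsD[OF XY(1)] and Y = fieldsD[OF XY(2)]
    show "rprod V X Y \<in> fields V"
      using X Y by simp
    show "rprod V X Y = rprod V Y X"
      using product_commute X Y smooth_vf_tangent by (simp add: restr_eq_iff vprod_def)
    have "rprod V (restr V e) X = restr V X"
      using unit_product smooth_vf_tangent[OF X(1)] by (simp add: restr_eq_iff vprod_def)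
    then show "rprod V (restr V e) X = X"
      using X by simp
    fix Z assume Z': "Z \<in> fields V"
    note Z = fieldsD[OF Z']
    show "rprod V (rprod V X Y) Z = rprod V X (rprod V Y Z)"
      using product_assoc X Y Z smooth_vf_tangent by (simp add: restr_eq_iff vprod_def)
    show "rprod V (X + Y) Z = rprod V X Z + rprod V Y Z"
      using product_add[OF smooth_vf_tangent[OF X(1)] smooth_vf_tangent[OF Z(1)]
          smooth_vf_tangent[OF Y(1)]]
      by (simp add: restr_add[symmetric] restr_eq_iff vprod_def)
    show "rinner V (rprod V X Y) Z = rinner V X (rprod V Y Z)"
      using product_invariant[OF X(1) Y(1) Z(1)] by (simp add: restr_args) (simp add: restr_eq_iff)
    fix W assume W': "W \<in> fields V"
    note W = fieldsD[OF W']
    note smooth = X(1) Y(1) Z(1) W(1)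
    show "rbr V (rprod V X Y) (rprod V Z W) - rprod V (rbr V (rprod V X Y) Z) W
          - rprod V Z (rbr V (rprod V X Y) W)
        = rprod V X (rbr V Y (rprod V Z W) - rprod V (rbr V Y Z) W - rprod V Z (rbr V Y W))
          + rprod V Y (rbr V X (rprod V Z W) - rprod V (rbr V X Z) W - rprod V Z (rbr V X W))"
      using Hertling_Manin_fields[OF smooth] smooth
      by (simp add: restr_args restr_diff[symmetric] restr_add[symmetric] smooth_vf_diff)
         (simp add: restr_eq_iff lie_product_def)
    show "curv Y Z (rprod V X W) + curv X Y (rprod V Z W) + curv Z X (rprod V Y W) = 0"
      using riemann_product[OF smooth] smooth
      by (simp add: curv_def restr_args restr_diff[symmetric] restr_add[symmetric] smooth_vf_diff)
         (simp add: restr_eq_0_iff riemann_def)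
  qed
qed

lemma chart_neighbourhood:
  assumes "openin (mtop M) U" "p \<in> U"
  obtains W \<phi> V where "(W, \<phi>) \<in> charts M" "openin (mtop M) V" "V \<subseteq> W" "V \<subseteq> U" "p \<in> V"
proof -
  obtain W \<phi> where c: "(W, \<phi>) \<in> charts M" and p: "p \<in> W"
    using chart_cover assms openin_subset by blast
  show thesis
    by (rule that[OF c openin_Int[OF assms(1) chart_open[OF c]]]) (use assms p in auto)
qed


subsection \<open>The connection\<close>

lemma metric_eqI:
  assumes "u \<in> tangent_space M p" "v \<in> tangent_space M p"
    and eq: "\<And>w. w \<in> tangent_space M p \<Longrightarrow> g p u w = g p v w"
  shows "u = v"
proof -
  have "u - v = 0"
  proof (rule metric_nondegenerate[OF tangent_diff[OF assms(1,2)]])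
    fix w assume w: "w \<in> tangent_space M p"
    have "g p ((u - v) + v) w = g p (u - v) w + g p v w"
      by (rule metric_add[OF tangent_diff[OF assms(1,2)] w assms(2)])
    then show "g p (u - v) w = 0"
      using eq[OF w] by simp
  qed
  then show ?thesis
    by simp
qed

text \<open>A vector satisfying the description in the definition of \<open>sharp\<close> is unique because every tangent vector
is a value of a local field; existence has to be supplied by the candidate \<open>v\<close>.\<close>

lemma sharp_eqI:
  assumes v: "v \<in> tangent_space M p"
    and eq: "\<And>U Y. p \<in> U \<Longrightarrow> smooth_vf M U Y \<Longrightarrow> g p v (Y p) = \<alpha> Y p"
  shows "sharp M g \<alpha> p = v"
  unfolding sharp_def
proof (rule the_equality)
  fix u assume u: "u \<in> tangent_space M p \<and> (\<forall>U Y. p \<in> U \<and> smooth_vf M U Y \<longrightarrow> g p u (Y p) = \<alpha> Y p)"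
  show "u = v"
  proof (rule metric_eqI)
    fix w assume w: "w \<in> tangent_space M p"
    obtain W \<phi> where c: "(W, \<phi>) \<in> charts M" "p \<in> W"
      using chart_cover[OF tangent_space_carr[OF w]] by blast
    then obtain Y where Y: "smooth_vf M W Y" "Y p = w"
      using tangent_extend[OF w] by blast
    then show "g p u w = g p v w"
      using u eq[OF c(2) Y(1)] c(2) by auto
  qed (use u v in auto)
qed (use v eq in auto)

text \<open>The field tested against may be defined on a different open set, so the abstract formula for
\<open>d\<theta>\<close> is applied on a chart neighbourhood contained in both domains.\<close>

lemma sharp_ext_deriv:
  assumes X: "smooth_vf M U X" and p: "p \<in> U"
  shows "sharp M g (contract X (ext_deriv M (vinner g e))) p = tscale 2 (LC X e p)"
proof (rule sharp_eqI)
  have tangent: "LC X e p \<in> tangent_space M p"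
    using smooth_vf_tangent[OF smooth_LC[OF X smooth_unit[OF smooth_vf_openin[OF X]]] p] .
  then show "tscale 2 (LC X e p) \<in> tangent_space M p"
    by (rule tangent_scale)
  fix U' Y assume pU': "p \<in> U'" and Y: "smooth_vf M U' Y"
  obtain W \<phi> V where c: "(W, \<phi>) \<in> charts M" and V: "openin (mtop M) V" "V \<subseteq> W"
    and sub: "V \<subseteq> U \<inter> U'" and pV: "p \<in> V"
    using chart_neighbourhood[of "U \<inter> U'" p] p pU' smooth_vf_openin[OF X] smooth_vf_openin[OF Y]
    by (metis IntI openin_Int)
  interpret F_module "fields V" "rbr V" "rLC V" "{f. smooth_fun M V f}" "ract V" "rinner V"
    "rprod V" "restr V e"
    by (rule F_module_fields[OF c V])
  have XV: "smooth_vf M V X" and YV: "smooth_vf M V Y" and eV: "smooth_vf M V e"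
    using smooth_vf_subset[OF X V(1)] smooth_vf_subset[OF Y V(1)] smooth_unit[OF V(1)] sub by auto
  have "X p (vinner g e Y) - Y p (vinner g e X) - vinner g e (lie_bracket M X Y) p
      = 2 * vinner g (LC X e) Y p"
    using ext_deriv_dual_unit[of "restr V X" "restr V Y" p] XV YV eV
    by (simp add: restr_args) (simp add: pV)
  then show "g p (tscale 2 (LC X e p)) (Y p) = contract X (ext_deriv M (vinner g e)) Y p"
    using metric_scale[OF tangent smooth_vf_tangent[OF Y pU']]
    by (simp add: contract_def ext_deriv_def vinner_def)
qed

definition nabla :: "'a conn" where
  "nabla X Y = LC X Y - vscale (\<lambda>_. 1 / 2)
     (sharp M g (contract (vprod m X Y) (ext_deriv M (vinner g e))))"

lemma nabla_LC:
  assumes "smooth_vf M U X" "smooth_vf M U Y" "p \<in> U"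
  shows "nabla X Y p = LC X Y p - LC (vprod m X Y) e p"
  using sharp_ext_deriv[OF smooth_vprod[OF assms(1,2)] assms(3)]
  by (simp add: nabla_def vscale_def tscale_def)

lemma smooth_nabla [simp]:
  assumes X: "smooth_vf M U X" and Y: "smooth_vf M U Y"
  shows "smooth_vf M U (nabla X Y)"
  by (rule smooth_vf_cong[of U "LC X Y - LC (vprod m X Y) e"])
     (simp_all add: X Y smooth_vf_diff smooth_unit[OF smooth_vf_openin[OF X]] nabla_LC[OF X Y])

lemma connection_nabla: "connection M nabla"
  unfolding connection_def
proof (intro conjI allI impI ballI)
  fix U X Y X' Y' p
  assume *: "smooth_vf M U X \<and> smooth_vf M U X' \<and> smooth_vf M U Y \<and> smooth_vf M U Y' \<and>
    (\<forall>p\<in>U. X p = X' p \<and> Y p = Y' p)" and p: "p \<in> U"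
  then have X: "smooth_vf M U X" "smooth_vf M U X'" and Y: "smooth_vf M U Y" "smooth_vf M U Y'"
    and eq: "\<And>p. p \<in> U \<Longrightarrow> X p = X' p" "\<And>p. p \<in> U \<Longrightarrow> Y p = Y' p"
    by auto
  have "LC X Y p = LC X' Y' p"
    by (rule LC_cong[OF X(1) Y(1) eq p])
  moreover have "LC (vprod m X Y) e p = LC (vprod m X' Y') e p"
    by (rule LC_cong[OF smooth_vprod[OF X(1) Y(1)] smooth_unit[OF smooth_vf_openin[OF X(1)]] _ _ p])
       (simp_all add: vprod_def eq)
  ultimately show "nabla X Y p = nabla X' Y' p"
    by (simp add: nabla_LC[OF X(1) Y(1) p] nabla_LC[OF X(2) Y(2) p])
next
  fix U X Y Z a p
  assume *: "smooth_vf M U X \<and> smooth_vf M U Y \<and> smooth_vf M U Z \<and> smooth_fun M U a"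
    and p: "p \<in> U"
  then have X: "smooth_vf M U X" and Y: "smooth_vf M U Y" and Z: "smooth_vf M U Z"
    and a: "smooth_fun M U a"
    by auto
  have e: "smooth_vf M U e"
    by (rule smooth_unit[OF smooth_vf_openin[OF X]])
  have prod_cong: "LC A e p = LC B e p" if "smooth_vf M U A" "\<And>q. q \<in> U \<Longrightarrow> A q = B q" for A B
    by (rule LC_cong[OF that(1) e that(2) _ p]) simp_all
  note tangent = smooth_vf_tangent[OF X] smooth_vf_tangent[OF Y] smooth_vf_tangent[OF Z]
  note sum = smooth_vf_add[OF X Y] smooth_vf_add[OF Y Z] smooth_vf_vscale[OF a X]
    smooth_vf_vscale[OF a Y]
  have "LC (vprod m (X + Y) Z) e p = LC (vprod m X Z + vprod m Y Z) e p"
    by (rule prod_cong[OF smooth_vprod[OF sum(1) Z]]) (use X Y Z sum tangent in \<open>simp_all add: vprod_def product_add\<close>)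
  then show "nabla (X + Y) Z p = nabla X Z p + nabla Y Z p"
    using LC_add_left[OF X Z p Y] LC_add_left[OF smooth_vprod[OF X Z] e p smooth_vprod[OF Y Z]]
    by (simp add: nabla_LC[OF sum(1) Z p] nabla_LC[OF X Z p] nabla_LC[OF Y Z p])
  have "LC (vprod m X (Y + Z)) e p = LC (vprod m X Y + vprod m X Z) e p"
    by (rule prod_cong[OF smooth_vprod[OF X sum(2)]]) (use X Y Z sum tangent in
        \<open>simp_all add: vprod_def product_commute[of "X _"] product_add tangent_add\<close>)
  then show "nabla X (Y + Z) p = nabla X Y p + nabla X Z p"
    using LC_add_right[OF X Y p Z] LC_add_left[OF smooth_vprod[OF X Y] e p smooth_vprod[OF X Z]]
    by (simp add: nabla_LC[OF X sum(2) p] nabla_LC[OF X Y p] nabla_LC[OF X Z p])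
  note scale = LC_scale_left[OF smooth_vprod[OF X Y] e p a]
  have "LC (vprod m (vscale a X) Y) e p = LC (vscale a (vprod m X Y)) e p"
    by (rule prod_cong[OF smooth_vprod[OF sum(3) Y]]) (use X Y sum tangent in \<open>simp_all add: vprod_def vscale_def product_scale\<close>)
  then show "nabla (vscale a X) Y p = tscale (a p) (nabla X Y p)"
    using LC_scale_left[OF X Y p a] scale
    by (simp add: nabla_LC[OF sum(3) Y p] nabla_LC[OF X Y p])
       (auto simp: tscale_def fun_eq_iff algebra_simps)
  have "LC (vprod m X (vscale a Y)) e p = LC (vscale a (vprod m X Y)) e p"
    by (rule prod_cong[OF smooth_vprod[OF X sum(4)]]) (use X Y sum tangent in \<open>simp_all add: vprod_def vscale_def
        product_commute[of "X _"] product_scale tangent_scale\<close>)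
  then show "nabla X (vscale a Y) p = tscale (X p a) (Y p) + tscale (a p) (nabla X Y p)"
    using LC_scale_right[OF X Y p a] scale
    by (simp add: nabla_LC[OF X sum(4) p] nabla_LC[OF X Y p])
       (auto simp: tscale_def fun_eq_iff algebra_simps)
qed simp

text \<open>The link by which identities of the abstract connection become identities of \<open>nabla\<close> on \<open>V\<close>.\<close>

lemma restr_nabla:
  assumes c: "(W, \<phi>) \<in> charts M" and V: "openin (mtop M) V" "V \<subseteq> W"
    and X: "smooth_vf M V X" and Y: "smooth_vf M V Y"
  shows "F_module.nab (rLC V) (rprod V) (restr V e) (restr V X) (restr V Y) = restr V (nabla X Y)"
proof -
  interpret F_module "fields V" "rbr V" "rLC V" "{f. smooth_fun M V f}" "ract V" "rinner V"
    "rprod V" "restr V e"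
    by (rule F_module_fields[OF c V])
  show ?thesis
    using X Y smooth_unit[OF V(1)]
    by (simp add: nab_def restr_args restr_diff[symmetric]) (simp add: restr_eq_iff nabla_LC)
qed

lemma torsionless_nabla: "torsionless M nabla"
  unfolding torsionless_def
proof (intro allI impI ballI)
  fix U X Y p assume "smooth_vf M U X \<and> smooth_vf M U Y" and p: "p \<in> U"
  then have X: "smooth_vf M U X" and Y: "smooth_vf M U Y"
    by auto
  have "LC (vprod m X Y) e p = LC (vprod m Y X) e p"
    by (rule LC_cong[OF smooth_vprod[OF X Y] smooth_unit[OF smooth_vf_openin[OF X]] _ _ p])
       (simp_all add: vprod_def product_commute smooth_vf_tangent[OF X] smooth_vf_tangent[OF Y])
  then show "(nabla X Y - nabla Y X - lie_bracket M X Y) p = 0"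
    by (simp add: nabla_LC[OF X Y p] nabla_LC[OF Y X p] lie_bracket_LC[OF X Y p])
qed

lemma nabla_pointwise:
  assumes X: "smooth_vf M U X" and Y: "smooth_vf M U Y" and Z: "smooth_vf M U Z" and p: "p \<in> U"
  shows "riemann M nabla X Y Z p = 0"
    and "nabla X e p = 0"
    and "cov_deriv_product nabla m X Y Z p = cov_deriv_product nabla m Y X Z p"
    and "cov_deriv_product nabla m X Y Z p = cov_deriv_product nabla m X Z Y p"
proof -
  obtain W \<phi> V where c: "(W, \<phi>) \<in> charts M" and V: "openin (mtop M) V" "V \<subseteq> W"
    and VU: "V \<subseteq> U" and pV: "p \<in> V"
    by (rule chart_neighbourhood[OF smooth_vf_openin[OF X] p])
  interpret F_module "fields V" "rbr V" "rLC V" "{f. smooth_fun M V f}" "ract V" "rinner V"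
    "rprod V" "restr V e"
    by (rule F_module_fields[OF c V])
  note XV = smooth_vf_subset[OF X V(1) VU] and YV = smooth_vf_subset[OF Y V(1) VU]
    and ZV = smooth_vf_subset[OF Z V(1) VU] and eV = smooth_unit[OF V(1)]
  note fields = restr_fields[OF XV] restr_fields[OF YV] restr_fields[OF ZV]
  note transfer = restr_nabla[OF c V] restr_args restr_diff[symmetric]
  have "restr V (riemann M nabla X Y Z) = 0"
    using nab_flat[OF fields] XV YV ZV
    by (simp add: nab.curv_def transfer) (simp add: riemann_def)
  then show "riemann M nabla X Y Z p = 0"
    using pV by (simp add: restr_eq_0_iff)
  have "restr V (nabla X e) = 0"
    using nab_unit[OF fields(1)] XV eV by (simp add: transfer)
  then show "nabla X e p = 0"
    using pV by (simp add: restr_eq_0_iff)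
  have "restr V (cov_deriv_product nabla m X Y Z) = restr V (cov_deriv_product nabla m Y X Z)"
    using nab_mul_exchange[OF fields] XV YV ZV
    by (simp add: transfer) (simp add: cov_deriv_product_def)
  then show "cov_deriv_product nabla m X Y Z p = cov_deriv_product nabla m Y X Z p"
    using pV by (simp add: restr_eq_iff)
  have "restr V (cov_deriv_product nabla m X Y Z) = restr V (cov_deriv_product nabla m X Z Y)"
    using nab_mul_commute[OF fields] XV YV ZV
    by (simp add: transfer) (simp add: cov_deriv_product_def)
  then show "cov_deriv_product nabla m X Y Z p = cov_deriv_product nabla m X Z Y p"
    using pV by (simp add: restr_eq_iff)
qed

lemma flat_F_manifold_nabla: "flat_F_manifold M m nabla e"
  unfolding flat_F_manifold_def flat_def
proof (intro conjI allI impI ballI)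
  fix U X p assume X: "smooth_vf M U X" and p: "p \<in> U"
  show "nabla X e p = 0"
    by (rule nabla_pointwise(2)[OF X X X p])
qed (simp_all add: manifold product unit connection_nabla torsionless_nabla,
    (blast intro: nabla_pointwise)+)

lemma second_deriv_Euler:
  assumes E: "smooth_vf M U E"
    and mult: "\<And>U X Y p. smooth_vf M U X \<Longrightarrow> smooth_vf M U Y \<Longrightarrow> p \<in> U \<Longrightarrow>
      lie_product M E m X Y p = vprod m X Y p"
    and hom: "\<And>U X Y p. smooth_vf M U X \<Longrightarrow> smooth_vf M U Y \<Longrightarrow> p \<in> U \<Longrightarrow>
      lie_metric M E g X Y p = d * vinner g X Y p"
    and X: "smooth_vf M U X" and Y: "smooth_vf M U Y" and p: "p \<in> U"
  shows "second_cov_deriv nabla X Y E p = 0"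
proof -
  obtain W \<phi> V where c: "(W, \<phi>) \<in> charts M" and V: "openin (mtop M) V" "V \<subseteq> W"
    and VU: "V \<subseteq> U" and pV: "p \<in> V"
    by (rule chart_neighbourhood[OF smooth_vf_openin[OF X] p])
  interpret F_module "fields V" "rbr V" "rLC V" "{f. smooth_fun M V f}" "ract V" "rinner V"
    "rprod V" "restr V e"
    by (rule F_module_fields[OF c V])
  note XV = smooth_vf_subset[OF X V(1) VU] and YV = smooth_vf_subset[OF Y V(1) VU]
    and EV = smooth_vf_subset[OF E V(1) VU]
  note transfer = restr_nabla[OF c V] restr_args restr_diff[symmetric]
  have scale: "rbr V (restr V E) (rprod V S T) - rprod V (rbr V (restr V E) S) T
      - rprod V S (rbr V (restr V E) T) = rprod V S T" if "S \<in> fields V" "T \<in> fields V" for S T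
    using mult[OF fieldsD(1)[OF that(1)] fieldsD(1)[OF that(2)]] EV fieldsD(1)[OF that(1)]
      fieldsD(1)[OF that(2)]
    by (simp add: transfer) (simp add: restr_eq_iff lie_product_def)
  have "restr V (second_cov_deriv nabla X Y E) = 0"
    using nab_nab_Euler[OF restr_fields[OF EV] homothetic_fields[OF c V EV hom] scale
        restr_fields[OF XV] restr_fields[OF YV]] XV YV EV
    by (simp add: transfer) (simp add: second_cov_deriv_def)
  then show ?thesis
    using pV by (simp add: restr_eq_0_iff)
qed

end

theorem theorem2p5:
  fixes M :: "('a, 'e::euclidean_space) mfd"
    and m :: "'a tproduct" and g :: "'a tmetric" and e E :: "'a vfield"
    and \<theta> :: "'a form1" and LC nabla :: "'a conn"
  assumes "homogeneous_riemannian_F_manifold_Killing_unit M m g e E"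
    and "levi_civita M g LC"
    and "\<And>X. \<theta> X = vinner g e X"
    and "\<And>X Y. nabla X Y =
           LC X Y - vscale (\<lambda>_. 1 / 2) (sharp M g (contract (vprod m X Y) (ext_deriv M \<theta>)))"
  shows "homogeneous_flat_F_manifold M m nabla e E"
proof -
  interpret F: Killing_F_manifold M m g e LC
    using assms(1,2)
    by unfold_locales (simp_all add: homogeneous_riemannian_F_manifold_Killing_unit_def)
  have "\<theta> = vinner g e"
    using assms(3) by blast
  then have nabla: "nabla = F.nabla"
    by (intro ext) (simp only: assms(4) F.nabla_def)
  note hom = assms(1)[unfolded homogeneous_riemannian_F_manifold_Killing_unit_def]
  have E: "smooth_vf M (carr M) E"
    using hom by blast
  have mult: "lie_product M E m X Y p = vprod m X Y p"
    if "smooth_vf M U X" "smooth_vf M U Y" "p \<in> U" for U X Y p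
    by (rule hom[THEN conjunct2, THEN conjunct2, THEN conjunct1, rule_format, of U])
       (simp_all add: that)
  obtain d where metric: "lie_metric M E g X Y p = d * vinner g X Y p"
    if "smooth_vf M U X" "smooth_vf M U Y" "p \<in> U" for U X Y p
    using hom[THEN conjunct2, THEN conjunct2, THEN conjunct2] by blast
  show ?thesis
    unfolding homogeneous_flat_F_manifold_def nabla
  proof (intro conjI allI impI ballI)
    fix U X Y p assume XY: "smooth_vf M U X \<and> smooth_vf M U Y" and p: "p \<in> U"
    show "lie_product M E m X Y p = vprod m X Y p"
      using mult XY p by blast
    have "openin (mtop M) U"
      using XY F.smooth_vf_openin by blast
    then have "smooth_vf M U E"
      using F.smooth_vf_subset[OF E] openin_subset by blast
    then show "second_cov_deriv F.nabla X Y E p = 0"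
      by (rule F.second_deriv_Euler[OF _ mult metric]) (use XY p in auto)
  qed (use E F.flat_F_manifold_nabla in auto)
qed

end
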